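(* For every integer $n>0$, $\mathrm{xc}(P_{G_n})=2^{\Omega(n)}$.
   Context: For $n\ge 1$ let $G_n=(U,V,E)$ be the bipartite multigraph with $|U|=|V|=n$ in which, for every $u\in U$ and $v\in V$, there are exactly two parallel edges between $u$ and $v$, one colored red and one colored blue. Let $\mathcal{M}_{\mathrm{all}}(G_n)$ be the set of perfect matchings of $G_n$ containing an odd number of red edges, and let $P_{G_n}:=\mathrm{conv}(\{\chi^M : M\in\mathcal{M}_{\mathrm{all}}(G_n)\})\subseteq\mathbb{R}^E$ (the odd-parity bipartite perfect matching polytope), where $\chi^M$ is the characteristic vector of $M$. The extension complexity $\mathrm{xc}(P)$ of a polytope $P$ is the smallest integer $r>0$ such that $P$ is a linear projection of some polytope with $r$ facets. *)

theory Defs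
  imports "HOL-Analysis.Analysis" "HOL-Analysis.Finite_Function_Topology"
begin

section \<open>Facets in arbitrary real vector spaces\<close>

text \<open>
  The dimension of the spaces below varies inside the statements, so we work in spaces of finitely
  supported functions, where \<^const>\<open>polytope\<close>, \<^const>\<open>face_of\<close> and \<^const>\<open>linear\<close> are available
  from the library. Its \<^const>\<open>aff_dim\<close> and \<^const>\<open>facet_of\<close> are restricted to
  \<^class>\<open>euclidean_space\<close>; the next two definitions repeat them without this restriction.
  They are meaningful for finite-dimensional sets only, which polytopes always are.
\<close>

definition affine_dimension :: "'a::real_vector set \<Rightarrow> int" where
  "affine_dimension S =
     (SOME d :: int. \<exists>B. affine hull B = affine hull S \<and> \<not> affine_dependent B \<and>
                         of_nat (card B) = d + 1)"

definition is_facet_of :: "'a::real_vector set \<Rightarrow> 'a set \<Rightarrow> bool" where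
  "is_facet_of F S \<longleftrightarrow>
     F face_of S \<and> F \<noteq> {} \<and> affine_dimension F = affine_dimension S - 1"

lemma affine_dimension_eq_aff_dim: "affine_dimension S = aff_dim S"
  by (simp add: affine_dimension_def aff_dim_def)

lemma is_facet_of_iff_facet_of: "is_facet_of F S \<longleftrightarrow> F facet_of S"
  by (simp add: is_facet_of_def facet_of_def affine_dimension_eq_aff_dim)


section \<open>Extension complexity\<close>

text \<open>
  The space \<^typ>\<open>nat \<Rightarrow>\<^sub>0 real\<close> is the increasing union of all spaces \<open>\<real>\<^sup>d\<close> (functions
  supported in \<open>{..<d}\<close>). A polytope in it is the convex hull of finitely many points, so it lies
  in some \<open>\<real>\<^sup>d\<close>, and every linear map on \<open>\<real>\<^sup>d\<close> extends to the whole space: \<open>Q\<close> below ranges over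
  the polytopes of all dimensions.
\<close>

definition extension_complexity :: "'a::real_vector set \<Rightarrow> nat" where
  "extension_complexity P =
     (LEAST r. r > 0 \<and>
        (\<exists>(Q :: (nat \<Rightarrow>\<^sub>0 real) set) (f :: (nat \<Rightarrow>\<^sub>0 real) \<Rightarrow> 'a).
           polytope Q \<and> card {F. is_facet_of F Q} = r \<and> linear f \<and> f ` Q = P))"


section \<open>The odd-parity bipartite perfect matching polytope\<close>

datatype colour = Red | Blue

text \<open>
  The vertices of \<open>U\<close> and of \<open>V\<close> are each numbered by \<open>{..<n}\<close>; the triple \<open>(u, v, c)\<close> is the
  edge of colour \<open>c\<close> between the vertex \<open>u\<close> of \<open>U\<close> and the vertex \<open>v\<close> of \<open>V\<close>.
\<close>

type_synonym edge = "nat \<times> nat \<times> colour"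

definition edges :: "nat \<Rightarrow> edge set" where
  "edges n = {..<n} \<times> {..<n} \<times> {Red, Blue}"

definition perfect_matching :: "nat \<Rightarrow> edge set \<Rightarrow> bool" where
  "perfect_matching n M \<longleftrightarrow>
     M \<subseteq> edges n \<and>
     (\<forall>u<n. \<exists>!e. e \<in> M \<and> fst e = u) \<and>
     (\<forall>v<n. \<exists>!e. e \<in> M \<and> fst (snd e) = v)"

definition odd_perfect_matchings :: "nat \<Rightarrow> edge set set" where
  "odd_perfect_matchings n =
     {M. perfect_matching n M \<and> odd (card {e \<in> M. snd (snd e) = Red})}"

text \<open>
  \<open>\<real>\<^sup>E\<close> is the subspace of the vectors in \<^typ>\<open>edge \<Rightarrow>\<^sub>0 real\<close> that are supported in \<open>E\<close>.
\<close>

definition char_vector :: "edge set \<Rightarrow> (edge \<Rightarrow>\<^sub>0 real)" where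
  "char_vector M = (\<Sum>e\<in>M. Poly_Mapping.single e 1)"

lemma lookup_char_vector:
  assumes "finite M"
  shows "Poly_Mapping.lookup (char_vector M) e = indicator M e"
  using assms by (simp add: char_vector_def lookup_sum lookup_single when_def indicator_def)

definition odd_matching_polytope :: "nat \<Rightarrow> (edge \<Rightarrow>\<^sub>0 real) set" where
  "odd_matching_polytope n = convex hull (char_vector ` odd_perfect_matchings n)"

end

theory Submission
  imports Defs "HOL-Real_Asymp.Real_Asymp"
begin

text \<open>
  By Yannakakis, an extension with \<open>r\<close> facets writes the slack matrix as a sum of \<open>r + 1\<close>
  nonnegative matrices of rank one. The rows used here are labellings of the vertices by bits: if
  a red edge is mismatched when its ends have equal labels and a blue edge when they have different
  ones, then under suitable parity every odd matching has an odd number of mismatches, and this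
  number minus one is a slack.

  As in Rothvoss' proof for the matching polytope, compare, in random positions, entries with 3
  mismatches (slack 2) and with 5 mismatches (slack 4). The former arise from the latter by
  resolving two of the 5 mismatched vertices; resolving one pair in the row and a disjoint pair in
  the column leaves a single mismatch, hence slack 0, where every summand vanishes. Among the 5
  cyclically adjacent pairs, those on which a summand is supported are therefore pairwise
  intersecting, and there are at most 2 of them. Because a dense set of the cube is balanced in
  almost all coordinates, the weight that a summand puts on the entries with 3 mismatches is thus
  at most about 2/5 of its weight on those with 5, up to an exponentially small error. The slacks
  have ratio 1/2, so exponentially many summands are needed.
\<close>

section \<open>Affine dimension and affine functionals\<close>

text \<open>The obstacle is that density balances most coordinates but says nothing about coordinate
  0, the core pair of a fixed frame. Hence each side has \<open>m\<close> reserve pairs that look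
  like its core pair, and everything is averaged over all permutations of the vertex numbers. Once
  the other side has resolved its core pair, exchanging that pair with a reserve pair leaves the
  other side unchanged, so coordinate 0 is as good as a random one.

  For this, \<open>X\<close> and \<open>Y\<close> must vary independently. An unstarred pair gets
  the labels 0 and 1, which suit a red swap as well as two blue loops; two starred vertices are also
  content with a red swap. So reserve pairs never mismatch, and the count depends on the core alone.

  The core has 1 + 2 + 2 vertices: two disjoint resolved pairs must leave a single mismatch. The gap
  between 2/5 and 1/2 pays for a tolerance of one percent in the balance and a loss of three percent
  on each side; this fixes the remaining constants. Only the exponential rate is affected by their
  choice.\<close>

lemma affine_basis_card_unique:
  fixes B C :: "'a::real_vector set"
  assumes hull: "affine hull C = affine hull B"
    and B: "\<not> affine_dependent B" "finite B" and C: "\<not> affine_dependent C"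
  shows "finite C \<and> card C = card B"
proof (cases "B = {}")
  case True
  then show ?thesis using hull by simp
next
  case False
  then obtain a where a: "a \<in> B" by blast
  have "C \<noteq> {}" using hull False by auto
  then obtain c where c: "c \<in> C" by blast
  define D where "D = (\<lambda>x. -a + x) ` (B - {a})"
  define E where "E = (\<lambda>x. -c + x) ` (C - {c})"
  have hB: "affine hull B = (\<lambda>x. a + x) ` span D"
    unfolding D_def by (rule affine_hull_span2[OF a])
  have hC: "affine hull C = (\<lambda>x. c + x) ` span E"
    unfolding E_def by (rule affine_hull_span2[OF c])
  have iD: "independent D" and iE: "independent E"
    using B C affine_dependent_iff_dependent2[OF a] affine_dependent_iff_dependent2[OF c]
    by (auto simp: D_def E_def)
  have "c \<in> (\<lambda>x. a + x) ` span D"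
    using hull hB c by (metis hull_inc)
  then obtain d where d: "d \<in> span D" "c = a + d" by auto
  \<comment> \<open>Both affine hulls are the same set, a translate of \<open>span D\<close> and of
    \<open>span E\<close>; as \<open>c\<close> lies in it, the two direction spaces agree.\<close>
  have "x \<in> span E \<longleftrightarrow> x \<in> span D" for x
  proof -
    have "x \<in> span E \<longleftrightarrow> c + x \<in> (\<lambda>x. c + x) ` span E" by auto
    also have "\<dots> \<longleftrightarrow> c + x \<in> (\<lambda>x. a + x) ` span D" using hull hB hC by simp
    also have "\<dots> \<longleftrightarrow> d + x \<in> span D"
      using d by (auto simp: add.assoc image_iff)
    also have "\<dots> \<longleftrightarrow> x \<in> span D"
      using d span_add_eq by blast
    finally show ?thesis .
  qed
  then have sp: "span E = span D" by blast
  have "finite D" using B by (simp add: D_def)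
  have "E \<subseteq> span D" using sp span_superset by blast
  then have fE: "finite E" using independent_span_bound[OF \<open>finite D\<close> iE] by blast
  have injs: "inj_on (\<lambda>x. -a + x) S" "inj_on (\<lambda>x. -c + x) S" for S
    by (auto simp: inj_on_def)
  have "card E = card D"
    using dim_eq_card[OF refl iE] dim_eq_card[OF sp[symmetric] iD] by simp
  then have "card (C - {c}) = card (B - {a})"
    by (simp add: D_def E_def card_image injs)
  moreover have "finite C"
    using finite_imageD[OF _ injs(2)] fE unfolding E_def by (metis finite_Diff2 finite.emptyI finite_insert)
  ultimately show ?thesis
    using card.remove[OF _ a] card.remove[OF _ c] B by simp
qed

text \<open>All affine bases have the size of \<open>B\<close>, so \<open>SOME\<close> in
  \<open>affine_dimension\<close> has only one value to choose.\<close>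

lemma affine_dimension_eq_card:
  fixes B :: "'a::real_vector set"
  assumes "affine hull B = affine hull S" "\<not> affine_dependent B" "finite B"
  shows "affine_dimension S = int (card B) - 1"
  unfolding affine_dimension_def
proof (rule some_equality)
  show "\<exists>C. affine hull C = affine hull S \<and> \<not> affine_dependent C \<and>
      int (card C) = int (card B) - 1 + 1"
    using assms by auto
  show "d = int (card B) - 1"
    if ex: "\<exists>C. affine hull C = affine hull S \<and> \<not> affine_dependent C \<and> int (card C) = d + 1" for d
  proof -
    obtain C where C: "affine hull C = affine hull S" "\<not> affine_dependent C" "int (card C) = d + 1"
      using ex by blast
    have "card C = card B"
      using affine_basis_card_unique[OF _ assms(2,3) C(2)] C(1) assms(1) by simp
    then show ?thesis using C(3) by simp
  qed
qed

text \<open>A basis of \<open>S\<close> extends to one of the hull of \<open>V\<close>, which has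
  the same size as a basis taken from the finite set \<open>V\<close>. So finiteness of dimension
  passes to all subsets of the hull.\<close>

lemma finite_affine_basis_exists:
  fixes S V :: "'a::real_vector set"
  assumes "finite V" "S \<subseteq> affine hull V"
  obtains B where "B \<subseteq> S" "finite B" "\<not> affine_dependent B" "affine hull B = affine hull S"
proof -
  obtain B where B: "B \<subseteq> S" "\<not> affine_dependent B" "affine hull S = affine hull B"
    using affine_basis_exists[of S] by blast
  have "B \<subseteq> affine hull V" by (rule subset_trans[OF B(1) assms(2)])
  obtain C where C: "\<not> affine_dependent C" "B \<subseteq> C" "C \<subseteq> affine hull V"
      "affine hull C = affine hull (affine hull V)"
    by (rule extend_to_affine_basis[OF B(2) \<open>B \<subseteq> affine hull V\<close>])
  obtain A where A: "A \<subseteq> V" "\<not> affine_dependent A" "affine hull V = affine hull A"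
    using affine_basis_exists[of V] by blast
  have "finite A" by (rule finite_subset[OF A(1) assms(1)])
  moreover have "affine hull C = affine hull A"
    using C(4) A(3) by (simp only: hull_hull)
  ultimately have "finite C"
    using affine_basis_card_unique[OF _ A(2) \<open>finite A\<close> C(1)] by simp
  then have "finite B" by (rule finite_subset[OF C(2)])
  then show ?thesis by (rule that[OF B(1) _ B(2) B(3)[symmetric]])
qed

lemma affine_independent_insert_outside:
  fixes B :: "'a::real_vector set"
  assumes B: "\<not> affine_dependent B" and v: "v \<notin> affine hull B"
  shows "\<not> affine_dependent (insert v B)"
proof (cases "B = {}")
  case True
  then show ?thesis by simp
next
  case False
  then obtain b where b: "b \<in> B" by blast
  define D where "D = (\<lambda>x. -b + x) ` (B - {b})"
  have "v \<noteq> b" using v b hull_inc by metis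
  have hB: "affine hull B = (\<lambda>x. b + x) ` span D"
    unfolding D_def by (rule affine_hull_span2[OF b])
  have "-b + v \<notin> span D"
  proof
    assume "-b + v \<in> span D"
    then have "b + (-b + v) \<in> affine hull B" unfolding hB by blast
    then show False using v by simp
  qed
  moreover have "independent D"
    using B affine_dependent_iff_dependent2[OF b] by (simp add: D_def)
  ultimately have "independent (insert (-b + v) D)" by (rule independent_insertI)
  moreover have "(\<lambda>x. -b + x) ` (insert v B - {b}) = insert (-b + v) D"
    using \<open>v \<noteq> b\<close> by (auto simp: D_def)
  ultimately show ?thesis
    using affine_dependent_iff_dependent2[of b "insert v B"] b by simp
qed

lemma affine_dimension_insert:
  fixes F Q V :: "'a::real_vector set"
  assumes V: "finite V" "F \<subseteq> affine hull V"
    and v: "v \<notin> affine hull F" and hull: "affine hull (insert v F) = affine hull Q"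
  shows "affine_dimension Q = affine_dimension F + 1"
proof -
  obtain B where B: "B \<subseteq> F" "finite B" "\<not> affine_dependent B" "affine hull B = affine hull F"
    using finite_affine_basis_exists[OF V] .
  have "affine hull (insert v B) = affine hull (insert v F)"
    using B(4) by (metis hull_insert)
  then have "affine hull (insert v B) = affine hull Q" using hull by simp
  moreover have "\<not> affine_dependent (insert v B)"
    using B v by (intro affine_independent_insert_outside) simp_all
  moreover have "v \<notin> B" using v B by (metis hull_inc)
  ultimately show ?thesis
    using affine_dimension_eq_card[of "insert v B" Q] affine_dimension_eq_card[of B F] B by simp
qed

definition affine_map :: "('a::real_vector \<Rightarrow> real) \<Rightarrow> bool" where
  "affine_map u \<longleftrightarrow> (\<exists>h c. linear h \<and> u = (\<lambda>x. h x + c))"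

lemma affine_map_const: "affine_map (\<lambda>_. c)"
  unfolding affine_map_def by (intro exI[of _ "\<lambda>_. 0"] exI[of _ c]) (simp add: linear_iff)

lemma affine_map_linear: "linear h \<Longrightarrow> affine_map h"
  unfolding affine_map_def by (intro exI[of _ h] exI[of _ 0]) simp

lemma affine_map_add:
  assumes "affine_map u" "affine_map w"
  shows "affine_map (\<lambda>x. u x + w x)"
proof -
  obtain h c h' c' where "linear h" "u = (\<lambda>x. h x + c)" "linear h'" "w = (\<lambda>x. h' x + c')"
    using assms unfolding affine_map_def by blast
  then show ?thesis
    unfolding affine_map_def
    by (intro exI[of _ "\<lambda>x. h x + h' x"] exI[of _ "c + c'"])
      (simp add: linear_compose_add fun_eq_iff)
qed

lemma affine_map_scale:
  assumes "affine_map u"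
  shows "affine_map (\<lambda>x. s * u x)"
proof -
  obtain h c where "linear h" "u = (\<lambda>x. h x + c)"
    using assms unfolding affine_map_def by blast
  then show ?thesis
    unfolding affine_map_def
    by (intro exI[of _ "\<lambda>x. s * h x"] exI[of _ "s * c"])
      (auto simp: linear_iff algebra_simps)
qed

lemma affine_map_diff:
  "affine_map u \<Longrightarrow> affine_map w \<Longrightarrow> affine_map (\<lambda>x. u x - w x)"
  using affine_map_add[of u "\<lambda>x. (-1) * w x"] affine_map_scale[of w "-1"] by simp

lemma affine_map_sum:
  "(\<And>i. i \<in> I \<Longrightarrow> affine_map (u i)) \<Longrightarrow> affine_map (\<lambda>x. \<Sum>i\<in>I. u i x)"
  by (induction I rule: infinite_finite_induct) (simp_all add: affine_map_const affine_map_add)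

lemma affine_map_compose_linear:
  assumes "affine_map u" "linear f"
  shows "affine_map (\<lambda>x. u (f x))"
proof -
  obtain h c where "linear h" "u = (\<lambda>x. h x + c)"
    using assms unfolding affine_map_def by blast
  then show ?thesis
    unfolding affine_map_def using linear_compose[OF assms(2), of h]
    by (intro exI[of _ "h \<circ> f"] exI[of _ c]) auto
qed

lemma affine_map_combination:
  assumes "affine_map u" "a + b = 1"
  shows "u (a *\<^sub>R x + b *\<^sub>R y) = a * u x + b * u y"
proof -
  obtain h c where h: "linear h" "u = (\<lambda>x. h x + c)"
    using assms unfolding affine_map_def by blast
  have "c = a * c + b * c" using assms(2) by (metis distrib_right mult_1)
  then show ?thesis using h by (simp add: linear_add linear_cmul algebra_simps)
qed

lemma affine_map_nonneg_hull:
  assumes "affine_map u" "\<And>v. v \<in> V \<Longrightarrow> 0 \<le> u v" "x \<in> convex hull V"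
  shows "0 \<le> u x"
proof -
  have "convex {x. 0 \<le> u x}"
    by (auto simp: convex_def affine_map_combination[OF assms(1)])
  then have "convex hull V \<subseteq> {x. 0 \<le> u x}"
    using assms(2) by (intro hull_minimal) auto
  then show ?thesis using assms(3) by auto
qed

lemma affine_map_zero_affine_hull:
  assumes "affine_map u" "\<And>v. v \<in> V \<Longrightarrow> u v = 0" "x \<in> affine hull V"
  shows "u x = 0"
proof -
  have "affine {x. u x = 0}"
    by (auto simp: affine_def affine_map_combination[OF assms(1)])
  then have "affine hull V \<subseteq> {x. u x = 0}"
    using assms(2) by (intro hull_minimal) auto
  then show ?thesis using assms(3) by auto
qed

lemma affine_map_eq_hull:
  assumes "affine_map u" "affine_map w" "\<And>v. v \<in> V \<Longrightarrow> u v = w v" "x \<in> convex hull V"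
  shows "u x = w x"
proof -
  have "x \<in> affine hull V" using assms(4) convex_hull_subset_affine_hull by blast
  then show ?thesis
    using affine_map_zero_affine_hull[OF affine_map_diff[OF assms(1,2)], of V x] assms(3) by simp
qed

lemma face_of_zero_set:
  assumes u: "affine_map u" and Q: "convex Q" "\<And>x. x \<in> Q \<Longrightarrow> 0 \<le> u x"
  shows "{x \<in> Q. u x = 0} face_of Q"
  unfolding face_of_def
proof (intro conjI ballI impI)
  show "convex {x \<in> Q. u x = 0}"
    using Q(1) by (auto simp: convex_def affine_map_combination[OF u])
next
  fix a b x assume ab: "a \<in> Q" "b \<in> Q" "x \<in> {x \<in> Q. u x = 0}" "x \<in> open_segment a b"
  then obtain t where t: "0 < t" "t < 1" "x = (1 - t) *\<^sub>R a + t *\<^sub>R b"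
    by (auto simp: in_segment)
  have z: "(1 - t) * u a + t * u b = 0"
    using ab t by (simp add: affine_map_combination[OF u])
  have "0 \<le> (1 - t) * u a" "0 \<le> t * u b" using ab Q t by auto
  then have "(1 - t) * u a = 0" "t * u b = 0" using z by linarith+
  then show "a \<in> {x \<in> Q. u x = 0}" "b \<in> {x \<in> Q. u x = 0}" using t ab by auto
qed auto

text \<open>A basis of the directions of \<open>S\<close> stays independent when
  \<open>-a + v\<close> is added, so a linear functional may be prescribed as 0 on the former and 1
  on the latter.\<close>

lemma affine_map_separate:
  assumes "v \<notin> affine hull S"
  obtains u where "affine_map u" "\<forall>x\<in>S. u x = 0" "u v \<noteq> 0"
proof (cases "S = {}")
  case True
  then show ?thesis using that[OF affine_map_const[of 1]] by simp
next
  case False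
  then obtain a where a: "a \<in> S" by blast
  define D where "D = (\<lambda>x. -a + x) ` (S - {a})"
  have hS: "affine hull S = (\<lambda>x. a + x) ` span D"
    unfolding D_def by (rule affine_hull_span2[OF a])
  have vD: "-a + v \<notin> span D"
  proof
    assume "-a + v \<in> span D"
    then have "a + (-a + v) \<in> affine hull S" unfolding hS by blast
    then show False using assms by simp
  qed
  obtain B where B: "B \<subseteq> D" "independent B" "D \<subseteq> span B"
    using maximal_independent_subset[of D] by blast
  have "span B = span D"
    using B by (metis span_mono span_span subset_antisym)
  then have "independent (insert (-a + v) B)"
    using B vD by (simp add: independent_insertI)
  then obtain h where h: "linear h" "\<forall>x\<in>insert (-a+v) B. h x = (if x = -a + v then 1 else (0::real))"
    using linear_independent_extend[of "insert (-a+v) B" "\<lambda>x. if x = -a + v then 1 else (0::real)"]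
    by blast
  have "-a + v \<notin> B" using vD \<open>span B = span D\<close> span_base by metis
  then have hB: "\<And>x. x \<in> B \<Longrightarrow> h x = 0" using h by auto
  have hD: "h x = 0" if "x \<in> span D" for x
    using linear_eq_0_on_span[OF h(1) hB] that \<open>span B = span D\<close> by blast
  show ?thesis
  proof (rule that[of "\<lambda>x. h x - h a"])
    show "affine_map (\<lambda>x. h x - h a)"
      by (intro affine_map_diff affine_map_linear h affine_map_const)
    have "h x - h a = 0" if "x \<in> S" for x
    proof (cases "x = a")
      case False
      then have "-a + x \<in> span D" using that by (auto simp: D_def intro: span_base)
      then have "h (x - a) = 0" using hD by simp
      then show ?thesis using linear_diff[OF h(1)] by simp
    qed simp
    then show "\<forall>x\<in>S. h x - h a = 0" by blast
    have "h (v - a) = 1" using h by simp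
    then show "h v - h a \<noteq> 0" using linear_diff[OF h(1)] by simp
  qed
qed

section \<open>Facets and extensions\<close>

text \<open>The zeros of \<open>u\<close> need just one further vertex \<open>w\<close> to span the
  whole hull, so the face where \<open>u\<close> vanishes has codimension one.\<close>

lemma facet_of_zero_set:
  fixes V :: "'a::real_vector set"
  assumes V: "finite V" and u: "affine_map u" "\<And>v. v \<in> V \<Longrightarrow> 0 \<le> u v"
    and z: "z \<in> V" "u z = 0" and w: "w \<in> V" "u w \<noteq> 0"
    and V_hull: "V \<subseteq> affine hull (insert w {v \<in> V. u v = 0})"
  shows "is_facet_of {x \<in> convex hull V. u x = 0} (convex hull V)"
proof -
  define F where "F = {x \<in> convex hull V. u x = 0}"
  have "F face_of convex hull V"
    unfolding F_def using u by (intro face_of_zero_set) (auto intro: affine_map_nonneg_hull)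
  moreover have "F \<noteq> {}" using z hull_inc[of z V] by (auto simp: F_def)
  moreover have "affine_dimension (convex hull V) = affine_dimension F + 1"
  proof (rule affine_dimension_insert[OF V])
    show "F \<subseteq> affine hull V"
      using convex_hull_subset_affine_hull[of V] by (auto simp: F_def)
    show "w \<notin> affine hull F"
    proof
      assume "w \<in> affine hull F"
      then have "u w = 0"
        by (rule affine_map_zero_affine_hull[OF u(1), rotated]) (simp add: F_def)
      then show False using w by simp
    qed
    have "insert w {v \<in> V. u v = 0} \<subseteq> insert w F"
      using hull_inc[of _ V convex] by (auto simp: F_def)
    then have "V \<subseteq> affine hull (insert w F)"
      using V_hull hull_mono[of _ "insert w F" affine] by blast
    then have "affine hull V \<subseteq> affine hull (insert w F)"
      by (rule hull_minimal) simp
    moreover have "insert w F \<subseteq> affine hull V"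
      using w hull_inc[of w V] convex_hull_subset_affine_hull[of V] by (auto simp: F_def)
    then have "affine hull (insert w F) \<subseteq> affine hull V"
      by (rule hull_minimal) simp
    ultimately have "affine hull (insert w F) = affine hull V" by (rule subset_antisym[rotated])
    then show "affine hull (insert w F) = affine hull (convex hull V)"
      by simp
  qed
  ultimately show ?thesis by (simp add: is_facet_of_def F_def)
qed

text \<open>
  Let \<open>u \<ge> 0\<close> on \<open>V\<close>. Either \<open>u\<close> is, up to scaling, the only affine functional vanishing on its
  zeros, and these span a facet (or are absent, and \<open>u\<close> is constant); or \<open>u\<close> is a nonnegative
  combination of two functionals with more zeros in \<open>V\<close>.
\<close>

lemma facet_functionals:
  fixes V :: "'a::real_vector set"
  assumes V: "finite V" and fin: "finite {F. is_facet_of F (convex hull V)}"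
  shows "\<exists>g. (\<forall>F. affine_map (g F)) \<and> (\<forall>F. \<forall>v\<in>V. 0 \<le> g F v) \<and>
    (\<forall>u. affine_map u \<longrightarrow> (\<forall>v\<in>V. 0 \<le> u v) \<longrightarrow>
       (\<exists>c l. 0 \<le> c \<and> (\<forall>F. 0 \<le> l F) \<and>
         (\<forall>v\<in>V. u v = c + (\<Sum>F | is_facet_of F (convex hull V). l F * g F v))))"
proof -
  define ok where "ok F h \<longleftrightarrow> affine_map h \<and> (\<forall>v\<in>V. 0 \<le> h v) \<and> (\<forall>x\<in>F. h x = 0) \<and> (\<exists>v\<in>V. h v \<noteq> 0)"
    for F and h :: "'a \<Rightarrow> real"
  \<comment> \<open>The default 0 makes \<open>g\<close> total; it is used for sets on which no
    suitable functional vanishes.\<close>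
  define g where "g F = (if \<exists>h. ok F h then SOME h. ok F h else (\<lambda>_. 0))" for F
  have g: "ok F (g F)" if "ok F h" for F h
    using someI[of "ok F" h] that by (auto simp: g_def)
  have g_affine: "affine_map (g F)" for F
    using g[of F] by (cases "\<exists>h. ok F h") (auto simp: ok_def g_def affine_map_const)
  have g_nonneg: "0 \<le> g F v" if "v \<in> V" for F v
    using g[of F] that by (cases "\<exists>h. ok F h") (auto simp: ok_def g_def)
  let ?Fs = "{F. is_facet_of F (convex hull V)}"
  let ?R = "\<lambda>u. \<exists>c l. 0 \<le> c \<and> (\<forall>F. 0 \<le> l F) \<and> (\<forall>v\<in>V. u v = c + (\<Sum>F\<in>?Fs. l F * g F v))"
  have R: "?R u" if "affine_map u" "\<And>v. v \<in> V \<Longrightarrow> 0 \<le> u v" for u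
    using that
  proof (induction "card {v \<in> V. u v \<noteq> 0}" arbitrary: u rule: less_induct)
    case (less u)
    define W where "W = {v \<in> V. u v \<noteq> 0}"
    have fW: "finite W" using V by (simp add: W_def)
    have uW: "0 < u v" if "v \<in> W" for v using less.prems(2)[of v] that by (auto simp: W_def)
    consider "W = {}"
      | h where "W \<noteq> {}" "affine_map h" "\<And>v. v \<in> V \<Longrightarrow> u v = 0 \<Longrightarrow> h v = 0"
          "\<And>s. \<exists>v\<in>V. h v \<noteq> s * u v"
      | "W \<noteq> {}" "\<And>h. affine_map h \<Longrightarrow> (\<And>v. v \<in> V \<Longrightarrow> u v = 0 \<Longrightarrow> h v = 0) \<Longrightarrow>
          \<exists>s. \<forall>v\<in>V. h v = s * u v"
      by blast
    then show ?case
    proof cases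
      case 1
      then show ?thesis
        by (intro exI[of _ 0] exI[of _ "\<lambda>_. 0"]) (auto simp: W_def)
    next
      case (2 h)
      \<comment> \<open>Let \<open>s\<close> and \<open>t\<close> be the extreme ratios of
        \<open>h\<close> to \<open>u\<close>. Then \<open>h - s * u\<close> and
        \<open>t * u - h\<close> are nonnegative on \<open>V\<close>, keep the zeros of
        \<open>u\<close>, gain a new one each (\<open>p\<close> and \<open>q\<close>), and add up to
        \<open>(t - s) * u\<close>.\<close>
      define Rt where "Rt = (\<lambda>v. h v / u v) ` W"
      have Rt: "finite Rt" "Rt \<noteq> {}" using fW 2 by (auto simp: Rt_def)
      define s t where "s = Min Rt" and "t = Max Rt"
      have lo: "s * u v \<le> h v" if "v \<in> V" for v
      proof (cases "v \<in> W")
        case True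
        then have "s \<le> h v / u v" using Rt by (auto simp: s_def Rt_def)
        then show ?thesis using uW[OF True] by (simp add: field_simps)
      qed (use that 2 in \<open>auto simp: W_def\<close>)
      have hi: "h v \<le> t * u v" if "v \<in> V" for v
      proof (cases "v \<in> W")
        case True
        then have "h v / u v \<le> t" using Rt by (auto simp: t_def Rt_def)
        then show ?thesis using uW[OF True] by (simp add: field_simps)
      qed (use that 2 in \<open>auto simp: W_def\<close>)
      have "s \<in> Rt" "t \<in> Rt" using Rt by (auto simp: s_def t_def)
      then obtain p q where p: "p \<in> W" "s = h p / u p" and q: "q \<in> W" "t = h q / u q"
        by (auto simp: Rt_def)
      have "s \<noteq> t"
        using lo hi 2(4)[of s] by (metis order_antisym)
      moreover have "s \<le> t" using Rt \<open>s \<in> Rt\<close> by (simp add: t_def)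
      ultimately have st: "s < t" by simp
      have "?R (\<lambda>x. h x - s * u x)"
      proof (rule less.hyps)
        have "{v \<in> V. h v - s * u v \<noteq> 0} \<subset> W"
        proof (rule psubsetI)
          show "{v \<in> V. h v - s * u v \<noteq> 0} \<subseteq> W" using 2(3) by (auto simp: W_def)
          have "p \<notin> {v \<in> V. h v - s * u v \<noteq> 0}" using p uW[OF p(1)] by simp
          then show "{v \<in> V. h v - s * u v \<noteq> 0} \<noteq> W" using p(1) by blast
        qed
        then show "card {v \<in> V. h v - s * u v \<noteq> 0} < card {v \<in> V. u v \<noteq> 0}"
          using fW by (auto simp flip: W_def intro: psubset_card_mono)
      qed (use lo less.prems 2 in \<open>auto intro: affine_map_diff affine_map_scale\<close>)
      then obtain c1 l1 where 1: "0 \<le> c1" "\<forall>F. 0 \<le> l1 F"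
        "\<forall>v\<in>V. h v - s * u v = c1 + (\<Sum>F\<in>?Fs. l1 F * g F v)"
        by blast
      have "?R (\<lambda>x. t * u x - h x)"
      proof (rule less.hyps)
        have "{v \<in> V. t * u v - h v \<noteq> 0} \<subset> W"
        proof (rule psubsetI)
          show "{v \<in> V. t * u v - h v \<noteq> 0} \<subseteq> W" using 2(3) by (auto simp: W_def)
          have "q \<notin> {v \<in> V. t * u v - h v \<noteq> 0}" using q uW[OF q(1)] by simp
          then show "{v \<in> V. t * u v - h v \<noteq> 0} \<noteq> W" using q(1) by blast
        qed
        then show "card {v \<in> V. t * u v - h v \<noteq> 0} < card {v \<in> V. u v \<noteq> 0}"
          using fW by (auto simp flip: W_def intro: psubset_card_mono)
      qed (use hi less.prems 2 in \<open>auto intro: affine_map_diff affine_map_scale\<close>)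
      then obtain c2 l2 where 2: "0 \<le> c2" "\<forall>F. 0 \<le> l2 F"
        "\<forall>v\<in>V. t * u v - h v = c2 + (\<Sum>F\<in>?Fs. l2 F * g F v)"
        by blast
      have "u v = (c1 + c2) / (t - s) + (\<Sum>F\<in>?Fs. (l1 F + l2 F) / (t - s) * g F v)"
        if "v \<in> V" for v
      proof -
        have "(t - s) * u v = (h v - s * u v) + (t * u v - h v)" by (simp add: algebra_simps)
        also have "\<dots> = (c1 + c2) + (\<Sum>F\<in>?Fs. (l1 F + l2 F) * g F v)"
          using 1(3) 2(3) that by (simp add: distrib_right sum.distrib)
        finally have "u v = ((c1 + c2) + (\<Sum>F\<in>?Fs. (l1 F + l2 F) * g F v)) / (t - s)"
          using st by (simp add: field_simps)
        then show ?thesis 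
            by (simp only: add_divide_distrib[of "c1 + c2"] sum_divide_distrib times_divide_eq_left)
      qed
      moreover have "0 \<le> (c1 + c2) / (t - s)" "\<forall>F. 0 \<le> (l1 F + l2 F) / (t - s)"
        using 1 2 st by simp_all
      ultimately show ?thesis
        by (intro exI[of _ "(c1 + c2) / (t - s)"] exI[of _ "\<lambda>F. (l1 F + l2 F) / (t - s)"]) blast
    next
      case 3
      then obtain w where w: "w \<in> W" by blast
      show ?thesis
      proof (cases "\<exists>z\<in>V. u z = 0")
        case False
        \<comment> \<open>Without zeros even the constant 1 must be proportional to
          \<open>u\<close>, so \<open>u\<close> is constant on \<open>V\<close>.\<close>
        then obtain s where s: "\<forall>v\<in>V. 1 = s * u v"
          using 3(2)[OF affine_map_const[of 1]] by blast
        have eq: "u v = u w" if "v \<in> V" for v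
        proof -
          have "s * u v = s * u w" "s \<noteq> 0" using s that w by (auto simp: W_def)
          then show ?thesis by simp
        qed
        show ?thesis
          using uW[OF w] eq
          by (intro exI[of _ "u w"] exI[of _ "\<lambda>_. 0"]) auto
      next
        case True
        then obtain z where z: "z \<in> V" "u z = 0" by blast
        define F where "F = {x \<in> convex hull V. u x = 0}"
        have "V \<subseteq> affine hull (insert w {v \<in> V. u v = 0})"
        proof
          fix v assume v: "v \<in> V"
          show "v \<in> affine hull (insert w {v \<in> V. u v = 0})"
          proof (rule ccontr)
            assume nv: "v \<notin> affine hull (insert w {v \<in> V. u v = 0})"
            obtain h where h: "affine_map h"
                "\<forall>x\<in>insert w {v \<in> V. u v = 0}. h x = 0" "h v \<noteq> 0"
              by (rule affine_map_separate[OF nv])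
            then obtain s where s: "\<forall>v\<in>V. h v = s * u v"
              using 3(2)[of h] by blast
            have "h w = 0" "h w = s * u w" using h(2) s w by (auto simp: W_def)
            then have "s = 0" using uW[OF w] by simp
            then show False using s h(3) v by simp
          qed
        qed
        then have facet: "is_facet_of F (convex hull V)"
          unfolding F_def using facet_of_zero_set[OF V less.prems z] w by (auto simp: W_def)
        have "ok F u"
          using less.prems w by (auto simp: ok_def F_def W_def)
        then have gF: "ok F (g F)" by (rule g)
        \<comment> \<open>The chosen \<open>g F\<close> vanishes wherever \<open>u\<close> does, so
          it can only be a multiple of \<open>u\<close>, and a positive one.\<close>
        have "\<exists>s. \<forall>v\<in>V. g F v = s * u v"
        proof (rule 3(2))
          show "g F v = 0" if "v \<in> V" "u v = 0" for v
            using gF that hull_inc[of v V] by (auto simp: ok_def F_def)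
        qed (rule g_affine)
        then obtain s where s: "\<forall>v\<in>V. g F v = s * u v" by blast
        have "s \<noteq> 0" using gF s by (auto simp: ok_def)
        moreover have "0 \<le> s * u w" using s g_nonneg[of w F] w by (auto simp: W_def)
        ultimately have "0 < s" using uW[OF w] by (simp add: zero_le_mult_iff)
        have "u v = 0 + (\<Sum>F'\<in>?Fs. (if F' = F then 1 / s else 0) * g F' v)" if "v \<in> V" for v
        proof -
          have "(\<Sum>F'\<in>?Fs. (if F' = F then 1 / s else 0) * g F' v) = 1 / s * g F v"
            using sum.delta[OF fin, of F "\<lambda>F'. 1 / s * g F' v"] facet
            by (simp add: if_distrib[of "\<lambda>x. x * _"] cong: if_cong)
          then show ?thesis using s that \<open>s \<noteq> 0\<close> by simp
        qed
        then show ?thesis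
          using \<open>0 < s\<close> by (intro exI[of _ 0] exI[of _ "\<lambda>F'. if F' = F then 1 / s else 0"]) auto
      qed
    qed
  qed
  show ?thesis using g_affine g_nonneg R by (intro exI[of _ g]) simp
qed

text \<open>With one facet \<open>F\<close>, every functional that is nonnegative on
  \<open>V\<close> would be a constant plus a nonnegative multiple of \<open>g F\<close>. But
  \<open>h - s\<close> and \<open>t - h\<close> vary in opposite directions. If \<open>V\<close> has
  at most one point there is no facet at all, because facets are nonempty.\<close>

lemma card_facets_ne_1:
  fixes V :: "'a::real_vector set"
  assumes V: "finite V"
  shows "card {F. is_facet_of F (convex hull V)} \<noteq> 1"
proof
  assume c1: "card {F. is_facet_of F (convex hull V)} = 1"
  then obtain F where F: "{F. is_facet_of F (convex hull V)} = {F}"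
    by (auto simp: card_1_singleton_iff)
  then have fin: "finite {F. is_facet_of F (convex hull V)}" by simp
  obtain g where g: "\<forall>F. affine_map (g F)" "\<forall>F. \<forall>v\<in>V. 0 \<le> g F v"
    "\<forall>u. affine_map u \<longrightarrow> (\<forall>v\<in>V. 0 \<le> u v) \<longrightarrow>
       (\<exists>c l. 0 \<le> c \<and> (\<forall>F. 0 \<le> l F) \<and>
         (\<forall>v\<in>V. u v = c + (\<Sum>F | is_facet_of F (convex hull V). l F * g F v)))"
    using facet_functionals[OF V fin] by (elim exE conjE) (rule that)
  have facet: "is_facet_of F (convex hull V)" using F by blast
  have "\<exists>x\<in>V. \<exists>y\<in>V. x \<noteq> y"
  proof (rule ccontr)
    assume "\<not> ?thesis"
    then obtain a where "V \<subseteq> {a}" by (cases "V = {}") blast+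
    then have "convex hull V \<subseteq> {a}" by (intro hull_minimal) auto
    moreover have "F \<subseteq> convex hull V" "F \<noteq> {}"
      using facet by (auto simp: is_facet_of_def face_of_def)
    ultimately have "F = convex hull V" by blast
    then show False using facet by (simp add: is_facet_of_def)
  qed
  then obtain x y where xy: "x \<in> V" "y \<in> V" "x \<noteq> y" by blast
  have "y \<notin> affine hull {x}" using xy by (simp add: hull_same)
  then obtain h where h: "affine_map h" "\<forall>z\<in>{x}. h z = 0" "h y \<noteq> 0"
    by (rule affine_map_separate)
  define s t where "s = Min (h ` V)" and "t = Max (h ` V)"
  have st: "s \<le> h v" "h v \<le> t" if "v \<in> V" for v
    using V that by (auto simp: s_def t_def)
  obtain c l where 1: "0 \<le> c" "\<forall>F. 0 \<le> l F" "\<forall>v\<in>V. h v - s = c + l F * g F v"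
    using g(3)[rule_format, of "\<lambda>v. h v - s", OF affine_map_diff[OF h(1) affine_map_const]] st F
    by auto
  obtain c' l' where 2: "0 \<le> c'" "\<forall>F. 0 \<le> l' F" "\<forall>v\<in>V. t - h v = c' + l' F * g F v"
    using g(3)[rule_format, of "\<lambda>v. t - h v", OF affine_map_diff[OF affine_map_const h(1)]] st F
    by auto
  have "h y - h x = l F * (g F y - g F x)"
    using 1(3)[rule_format, OF xy(1)] 1(3)[rule_format, OF xy(2)]
    unfolding right_diff_distrib by linarith
  moreover have "h x - h y = l' F * (g F y - g F x)"
    using 2(3)[rule_format, OF xy(1)] 2(3)[rule_format, OF xy(2)]
    unfolding right_diff_distrib by linarith
  ultimately have "(l F + l' F) * (g F y - g F x) = 0" and "l F \<noteq> 0" "g F y - g F x \<noteq> 0"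
    using h by (auto simp: algebra_simps)
  moreover have "l F + l' F > 0"
    using 1(2) 2(2) \<open>l F \<noteq> 0\<close> by (metis add_pos_nonneg order_less_le)
  ultimately show False by simp
qed

text \<open>Write a point \<open>x\<close> of \<open>F\<close> as a convex combination. If
  \<open>v\<close> has positive weight, \<open>x\<close> lies between \<open>v\<close> and the
  normalized combination \<open>w\<close> of the other points, so the face property puts
  \<open>v\<close> into \<open>F\<close>.\<close>

lemma face_of_convex_hull_eq:
  fixes V :: "'a::real_vector set"
  assumes V: "finite V" and F: "F face_of convex hull V"
  shows "F = convex hull (F \<inter> V)"
proof
  have FQ: "F \<subseteq> convex hull V" and cF: "convex F"
    and ext: "\<And>a b x. a \<in> convex hull V \<Longrightarrow> b \<in> convex hull V \<Longrightarrow> x \<in> F \<Longrightarrow>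
        x \<in> open_segment a b \<Longrightarrow> a \<in> F \<and> b \<in> F"
    using F by (auto simp: face_of_def)
  show "convex hull (F \<inter> V) \<subseteq> F" using cF by (intro hull_minimal) auto
  show "F \<subseteq> convex hull (F \<inter> V)"
  proof
    fix x assume x: "x \<in> F"
    then obtain c where c: "\<forall>v\<in>V. 0 \<le> c v" "sum c V = 1" "(\<Sum>v\<in>V. c v *\<^sub>R v) = x"
      using FQ by (auto simp: convex_hull_finite[OF V])
    have vF: "v \<in> F" if v: "v \<in> V" "c v \<noteq> 0" for v
    proof (cases "c v = 1")
      case True
      have "sum c (V - {v}) = 0" using c(2) True V v by (simp add: sum_diff1)
      then have "\<forall>w\<in>V-{v}. c w = 0"
        using c(1) V by (subst (asm) sum_nonneg_eq_0_iff) auto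
      then have "x = c v *\<^sub>R v"
        using c(3) V v by (simp add: sum.remove)
      then show ?thesis using x True by simp
    next
      case False
      have s1: "sum c (V - {v}) = 1 - c v" using c(2) V v by (simp add: sum_diff1)
      moreover have "0 \<le> sum c (V - {v})" using c(1) by (intro sum_nonneg) auto
      ultimately have lt: "0 < c v" "c v < 1" using c(1) v False by force+
      define w where "w = (\<Sum>u\<in>V - {v}. (c u / (1 - c v)) *\<^sub>R u)"
      have "w \<in> convex hull (V - {v})"
        unfolding convex_hull_finite[OF finite_Diff[OF V]]
        using c(1) lt s1 by (auto simp: w_def sum_divide_distrib[symmetric] intro!: exI[of _ "\<lambda>u. c u / (1 - c v)"])
      then have w: "w \<in> convex hull V" using hull_mono[of "V - {v}" V] by blast
      have "(1 - c v) *\<^sub>R w = (\<Sum>u\<in>V - {v}. c u *\<^sub>R u)"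
        using lt by (simp add: w_def scaleR_sum_right)
      then have xe: "x = (1 - c v) *\<^sub>R w + c v *\<^sub>R v"
        using c(3) V v by (simp add: sum.remove[of V v] add.commute)
      show ?thesis
      proof (cases "v = w")
        case True
        then have "x = v" using xe by (simp flip: scaleR_add_left)
        then show ?thesis using x by simp
      next
        case False
        then have "x \<in> open_segment w v" using xe lt by (auto simp: in_segment)
        then show ?thesis using ext[OF w hull_inc[OF v(1)] x] by simp
      qed
    qed
    have "(\<Sum>v\<in>F \<inter> V. c v *\<^sub>R v) = x" "sum c (F \<inter> V) = 1"
      unfolding c(3)[symmetric] c(2)[symmetric]
      using vF V by (auto intro!: sum.mono_neutral_left)
    then show "x \<in> convex hull (F \<inter> V)"
      using c(1) V by (auto simp: convex_hull_finite)
  qed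
qed

lemma finite_facets:
  fixes V :: "'a::real_vector set"
  assumes "finite V"
  shows "finite {F. is_facet_of F (convex hull V)}"
proof (rule finite_surj)
  show "{F. is_facet_of F (convex hull V)} \<subseteq> (\<lambda>W. convex hull W) ` Pow V"
    using face_of_convex_hull_eq[OF assms] by (force simp: is_facet_of_def)
qed (use assms in simp)

section \<open>Existence of extensions, and the factorizations they yield\<close>

lemma lookup_scaleR:
  "Poly_Mapping.lookup (r *\<^sub>R x) i = r * Poly_Mapping.lookup x i"
  for x :: "'a \<Rightarrow>\<^sub>0 real"
proof -
  have "finite {i. r * Poly_Mapping.lookup x i \<noteq> 0}"
    by (rule finite_subset[OF _ finite_lookup[of x]]) auto
  then show ?thesis
    by (simp add: scaleR_poly_mapping_def Abs_poly_mapping_inverse)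
qed

lemma linear_lookup: "linear (\<lambda>x :: 'a \<Rightarrow>\<^sub>0 real. Poly_Mapping.lookup x i)"
  by (simp add: linear_iff lookup_add lookup_scaleR)

text \<open>The predicate under \<open>LEAST\<close> in \<open>extension_complexity\<close>, named
  so that \<open>LeastI\<close> can be applied to it.\<close>

definition has_extension :: "'a::real_vector set \<Rightarrow> nat \<Rightarrow> bool" where
  "has_extension P r \<longleftrightarrow> r > 0 \<and>
     (\<exists>(Q :: (nat \<Rightarrow>\<^sub>0 real) set) (f :: (nat \<Rightarrow>\<^sub>0 real) \<Rightarrow> 'a).
        polytope Q \<and> card {F. is_facet_of F Q} = r \<and> linear f \<and> f ` Q = P)"

text \<open>A simplex maps onto the hull by sending its vertices to the points of \<open>W\<close>.
  Existence is what gives the minimum in \<open>extension_complexity\<close> a meaning.\<close>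

lemma has_extension_hull:
  fixes W :: "'a::real_vector set"
  assumes W: "finite W" "W \<noteq> {}"
  shows "\<exists>r. has_extension (convex hull W) r"
proof -
  obtain b where b: "bij_betw b {..<card W} W"
    using bij_betw_from_nat_into_finite[OF W(1)] by blast
  define k where "k = card W"
  have k: "0 < k" using W by (simp add: k_def card_gt_0_iff)
  \<comment> \<open>One vertex is doubled, so that the simplex has facets even when \<open>W\<close> is a singleton.\<close>
  define w where "w i = (if i < k then b i else b 0)" for i
  have wW: "w ` {..k} = W"
  proof
    show "w ` {..k} \<subseteq> W" using b k by (auto simp: w_def k_def bij_betw_def)
    show "W \<subseteq> w ` {..k}"
    proof
      fix x assume "x \<in> W"
      then obtain i where "i < k" "x = b i" using b by (auto simp: k_def bij_betw_def)
      then show "x \<in> w ` {..k}" by (intro image_eqI[of _ _ i]) (auto simp: w_def)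
    qed
  qed
  define e :: "nat \<Rightarrow> nat \<Rightarrow>\<^sub>0 real" where "e i = Poly_Mapping.single i 1" for i
  define V where "V = e ` {..k}"
  define f where "f x = (\<Sum>i\<le>k. Poly_Mapping.lookup x i *\<^sub>R w i)" for x :: "nat \<Rightarrow>\<^sub>0 real"
  have lf: "linear f"
    by (simp add: linear_iff f_def lookup_add lookup_scaleR scaleR_add_left sum.distrib
        scaleR_sum_right)
  have fe: "f (e i) = w i" if "i \<le> k" for i
  proof -
    have "f (e i) = (\<Sum>j\<le>k. if j = i then w j else 0)"
      unfolding f_def by (intro sum.cong) (auto simp: e_def lookup_single when_def)
    then show ?thesis using that by simp
  qed
  have fV: "f ` V = W"
    unfolding V_def image_image wW[symmetric] using fe by (intro image_cong) auto
  have finV: "finite V" by (simp add: V_def)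
  have "card {F. is_facet_of F (convex hull V)} \<noteq> 0"
  proof
    assume "card {F. is_facet_of F (convex hull V)} = 0"
    then have no: "{F. is_facet_of F (convex hull V)} = {}"
      using finite_facets[OF finV] by simp
    \<comment> \<open>Without facets, \<open>facet_functionals\<close> would make every nonnegative
      functional constant on \<open>V\<close>, but coordinate 0 distinguishes \<open>e 0\<close>
      from \<open>e k\<close>.\<close>
    let ?u = "\<lambda>x :: nat \<Rightarrow>\<^sub>0 real. Poly_Mapping.lookup x 0"
    have "\<forall>v\<in>V. 0 \<le> ?u v" by (auto simp: V_def e_def lookup_single when_def)
    moreover have "affine_map ?u" by (intro affine_map_linear linear_lookup)
    ultimately have "\<exists>c. \<forall>v\<in>V. ?u v = c"
      using facet_functionals[OF finV finite_facets[OF finV]]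
      unfolding no by (elim exE conjE allE[of _ ?u]) auto
    moreover have "e 0 \<in> V" "e k \<in> V" by (simp_all add: V_def)
    moreover have "?u (e 0) = 1" "?u (e k) = 0"
      using k by (simp_all add: e_def lookup_single when_def)
    ultimately show False by (metis zero_neq_one)
  qed
  then have "has_extension (convex hull W) (card {F. is_facet_of F (convex hull V)})"
    unfolding has_extension_def
    using lf finV convex_hull_linear_image[OF lf, of V] fV
    by (intro conjI exI[of _ "convex hull V"] exI[of _ f]) (auto simp: polytope_def)
  then show ?thesis by blast
qed

lemma extension_complexity_hull:
  fixes W :: "'a::real_vector set"
  assumes "finite W" "W \<noteq> {}"
  shows "has_extension (convex hull W) (extension_complexity (convex hull W))"
proof -
  obtain r where "has_extension (convex hull W) r" using has_extension_hull[OF assms] by blast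
  then have "has_extension (convex hull W) (LEAST r. has_extension (convex hull W) r)"
    by (rule LeastI)
  moreover have "(LEAST r. has_extension (convex hull W) r) = extension_complexity (convex hull W)"
    unfolding extension_complexity_def has_extension_def ..
  ultimately show ?thesis by simp
qed

text \<open>The value 0 is excluded by definition and 1 by \<open>card_facets_ne_1\<close>. This
  settles the finitely many small \<open>n\<close> of the final theorem.\<close>

lemma extension_complexity_ge_2:
  fixes W :: "'a::real_vector set"
  assumes "finite W" "W \<noteq> {}"
  shows "2 \<le> extension_complexity (convex hull W)"
proof -
  obtain Q :: "(nat \<Rightarrow>\<^sub>0 real) set" where "polytope Q"
    "card {F. is_facet_of F Q} = extension_complexity (convex hull W)"
    and pos: "extension_complexity (convex hull W) > 0"
    using extension_complexity_hull[OF assms] unfolding has_extension_def by blast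
  then have "extension_complexity (convex hull W) \<noteq> 1"
    using card_facets_ne_1 unfolding polytope_def by metis
  then show ?thesis using pos by linarith
qed

text \<open>Yannakakis' factorization; the index \<open>{}\<close>, which is never a facet, carries the constants.\<close>

lemma slack_factorization:
  fixes W :: "'a::real_vector set" and L :: "'r \<Rightarrow> 'a \<Rightarrow> real"
  assumes W: "finite W" "W \<noteq> {}"
    and L: "\<And>i. affine_map (L i)" "\<And>i w. w \<in> W \<Longrightarrow> 0 \<le> L i w"
  obtains I :: "(nat \<Rightarrow>\<^sub>0 real) set set" and f g where
    "finite I" "card I \<le> extension_complexity (convex hull W) + 1"
    "\<forall>i j. 0 \<le> f j i" "\<forall>w\<in>W. \<forall>j. 0 \<le> g j w"
    "\<forall>i. \<forall>w\<in>W. L i w = (\<Sum>j\<in>I. f j i * g j w)"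
proof -
  obtain Q :: "(nat \<Rightarrow>\<^sub>0 real) set" and p where Q: "polytope Q"
    and card: "card {F. is_facet_of F Q} = extension_complexity (convex hull W)"
    and p: "linear p" "p ` Q = convex hull W"
    using extension_complexity_hull[OF W] unfolding has_extension_def by blast
  obtain V where V: "finite V" "Q = convex hull V" using Q unfolding polytope_def by blast
  let ?Fs = "{F. is_facet_of F (convex hull V)}"
  have fin: "finite ?Fs" by (rule finite_facets[OF V(1)])
  obtain h where h: "\<forall>F. affine_map (h F)" "\<forall>F. \<forall>v\<in>V. 0 \<le> h F v"
    "\<forall>u. affine_map u \<longrightarrow> (\<forall>v\<in>V. 0 \<le> u v) \<longrightarrow>
       (\<exists>c l. 0 \<le> c \<and> (\<forall>F. 0 \<le> l F) \<and> (\<forall>v\<in>V. u v = c + (\<Sum>F\<in>?Fs. l F * h F v)))"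
    using facet_functionals[OF V(1) fin] by (elim exE conjE) (rule that)
  have "\<forall>w\<in>W. \<exists>y\<in>Q. p y = w"
  proof
    fix w assume "w \<in> W"
    then have "w \<in> p ` Q" unfolding p(2) by (rule hull_inc)
    then show "\<exists>y\<in>Q. p y = w" by blast
  qed
  then obtain y where y: "\<forall>w\<in>W. y w \<in> Q \<and> p (y w) = w" by metis
  have "\<exists>c l. 0 \<le> c \<and> (\<forall>F. 0 \<le> l F) \<and>
      (\<forall>w\<in>W. L i w = c + (\<Sum>F\<in>?Fs. l F * h F (y w)))" for i
  proof -
    \<comment> \<open>Pulled back along the projection, a slack is nonnegative on the vertices of
      \<open>Q\<close>, hence a combination of facet functionals. Evaluating it at a preimage
      \<open>y w\<close> of each point separates the dependence on \<open>i\<close> from that on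
      \<open>w\<close>.\<close>
    have aff: "affine_map (\<lambda>x. L i (p x))" by (rule affine_map_compose_linear[OF L(1) p(1)])
    have "0 \<le> L i (p v)" if "v \<in> V" for v
    proof -
      have "p v \<in> convex hull W" using that V(2) p(2) hull_inc[of v V convex] by blast
      then show ?thesis using affine_map_nonneg_hull[OF L(1) L(2)] by blast
    qed
    then obtain c l where cl: "0 \<le> c" "\<forall>F. 0 \<le> l F"
        "\<forall>v\<in>V. L i (p v) = c + (\<Sum>F\<in>?Fs. l F * h F v)"
      using h(3)[rule_format, OF aff] by blast
    have aff2: "affine_map (\<lambda>x. c + (\<Sum>F\<in>?Fs. l F * h F x))"
      using h(1) by (intro affine_map_add affine_map_const affine_map_sum affine_map_scale) blast
    have "L i w = c + (\<Sum>F\<in>?Fs. l F * h F (y w))" if "w \<in> W" for w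
      using affine_map_eq_hull[OF aff aff2, of V "y w"] cl(3) y that V(2) by auto
    then show ?thesis using cl by blast
  qed
  then obtain c l where cl: "\<And>i. 0 \<le> c i" "\<And>i F. 0 \<le> l i F"
      "\<And>i w. w \<in> W \<Longrightarrow> L i w = c i + (\<Sum>F\<in>?Fs. l i F * h F (y w))"
    by metis
  define f where "f F i = (if F = {} then c i else l i F)" for F i
  define g where "g F w = (if F = {} then 1 else h F (y w))" for F w
  have ne: "{} \<notin> ?Fs" by (auto simp: is_facet_of_def)
  show ?thesis
  proof (rule that[of "insert {} ?Fs" f g])
    show "finite (insert {} ?Fs)" using fin by simp
    show "card (insert {} ?Fs) \<le> extension_complexity (convex hull W) + 1"
      using card V(2) ne fin by simp
    show "\<forall>i j. 0 \<le> f j i" using cl by (simp add: f_def)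
    show "\<forall>w\<in>W. \<forall>j. 0 \<le> g j w"
      using affine_map_nonneg_hull[of "h _" V] h y V(2) by (auto simp: g_def)
    show "\<forall>i. \<forall>w\<in>W. L i w = (\<Sum>j\<in>insert {} ?Fs. f j i * g j w)"
    proof (intro allI ballI)
      fix i w assume "w \<in> W"
      have "(\<Sum>j\<in>?Fs. f j i * g j w) = (\<Sum>F\<in>?Fs. l i F * h F (y w))"
        using ne by (intro sum.cong) (auto simp: f_def g_def)
      then show "L i w = (\<Sum>j\<in>insert {} ?Fs. f j i * g j w)"
        using cl(3)[OF \<open>w \<in> W\<close>] ne fin by (simp add: f_def g_def)
    qed
  qed
qed

section \<open>Unbalanced coordinates\<close>

text \<open>The quadratic upper bounds for the two exponentials have opposite linear terms, which
  cancel.\<close>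

lemma exp_plus_exp_minus_le:
  fixes x :: real
  assumes "0 \<le> x" "x \<le> 1"
  shows "exp x + exp (- x) \<le> 2 * exp (x\<^sup>2)"
proof -
  have "exp x \<le> 1 + x + x\<^sup>2" using exp_bound[OF assms] .
  moreover have "exp (- x) \<le> 1 - x + x\<^sup>2"
  proof -
    have "1 \<le> (1 - x + x\<^sup>2) * (1 + x)"
      using assms by (simp add: algebra_simps power2_eq_square)
    also have "\<dots> \<le> (1 - x + x\<^sup>2) * exp x"
    proof (rule mult_left_mono)
      show "1 + x \<le> exp x" by (rule exp_ge_add_one_self)
      show "0 \<le> 1 - x + x\<^sup>2" using assms zero_le_power2[of x] by linarith
    qed
    finally show ?thesis by (simp add: exp_minus field_simps)
  qed
  moreover have "1 + x\<^sup>2 \<le> exp (x\<^sup>2)" by (rule exp_ge_add_one_self)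
  ultimately show ?thesis by linarith
qed

text \<open>This is the moment generating function of a sum of independent signs. It factors over
  the coordinates by \<open>prod_add\<close>, and each coordinate outside \<open>B\<close>
  contributes a factor 2.\<close>

lemma sum_Pow_exp_signs_le:
  fixes s :: "'a \<Rightarrow> real" and x :: real
  assumes I: "finite I" "B \<subseteq> I" and x: "0 \<le> x" "x \<le> 1"
    and s: "\<And>e. e \<in> B \<Longrightarrow> s e = 1 \<or> s e = - 1"
  shows "(\<Sum>X\<in>Pow I. exp (x * (\<Sum>e\<in>B. if e \<in> X then s e else - s e)))
      \<le> 2 ^ card I * exp (x\<^sup>2 * real (card B))"
proof -
  define p where "p e = (if e \<in> B then exp (x * s e) else 1)" for e
  define q where "q e = (if e \<in> B then exp (- (x * s e)) else 1)" for e
  have fB: "finite B" using I finite_subset by blast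
  have "exp (x * (\<Sum>e\<in>B. if e \<in> X then s e else - s e)) = (\<Prod>e\<in>X. p e) * (\<Prod>e\<in>I-X. q e)"
    if X: "X \<in> Pow I" for X
  proof -
    have "exp (x * (\<Sum>e\<in>B. if e \<in> X then s e else - s e))
        = (\<Prod>e\<in>B. if e \<in> X then p e else q e)"
      unfolding sum_distrib_left exp_sum[OF fB]
      by (intro prod.cong) (auto simp: p_def q_def)
    also have "\<dots> = (\<Prod>e\<in>I. if e \<in> X then p e else q e)"
      using I by (intro prod.mono_neutral_left) (auto simp: p_def q_def)
    also have "\<dots> = (\<Prod>e\<in>I-X. if e \<in> X then p e else q e) * (\<Prod>e\<in>X. if e \<in> X then p e else q e)"
      using X I by (intro prod.subset_diff) auto
    also have "\<dots> = (\<Prod>e\<in>I-X. q e) * (\<Prod>e\<in>X. p e)"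
      by (intro arg_cong2[of _ _ _ _ "(*)"] prod.cong) auto
    finally show ?thesis by (simp add: mult.commute)
  qed
  then have "(\<Sum>X\<in>Pow I. exp (x * (\<Sum>e\<in>B. if e \<in> X then s e else - s e)))
      = (\<Prod>e\<in>I. p e + q e)"
    using prod_add[OF I(1), of p q] by simp
  also have "\<dots> \<le> (\<Prod>e\<in>I. if e \<in> B then 2 * exp (x\<^sup>2) else 2)"
  proof (intro prod_mono conjI)
    fix e assume "e \<in> I"
    show "0 \<le> p e + q e" by (auto simp: p_def q_def intro: add_nonneg_nonneg)
    show "p e + q e \<le> (if e \<in> B then 2 * exp (x\<^sup>2) else 2)"
      using s[of e] exp_plus_exp_minus_le[OF x] by (auto simp: p_def q_def)
  qed
  also have "\<dots> = (\<Prod>e\<in>I. 2 * (if e \<in> B then exp (x\<^sup>2) else 1))"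
    by (intro prod.cong) auto
  also have "\<dots> = 2 ^ card I * (\<Prod>e\<in>I. if e \<in> B then exp (x\<^sup>2) else 1)"
    by (simp add: prod.distrib)
  also have "(\<Prod>e\<in>I. if e \<in> B then exp (x\<^sup>2) else 1) = (\<Prod>e\<in>B. exp (x\<^sup>2))"
    using I by (intro prod.mono_neutral_cong_right) auto
  also have "\<dots> = exp (x\<^sup>2 * real (card B))"
    by (simp add: exp_of_nat2_mult)
  finally show ?thesis .
qed

text \<open>A large set of the cube has few biased coordinates: compare the average of the exponential
  of the signed sum over the biased coordinates with its value at the average.\<close>

lemma biased_coordinates_bound:
  fixes F :: "'a set \<Rightarrow> real"
  assumes I: "finite I" "B \<subseteq> I" and \<eta>: "0 \<le> \<eta>" "\<eta> \<le> 1"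
    and F: "\<And>X. X \<subseteq> I \<Longrightarrow> 0 \<le> F X" "\<And>X. X \<subseteq> I \<Longrightarrow> F X \<le> a"
    and biased: "\<And>e. e \<in> B \<Longrightarrow> \<eta> * sum F (Pow I) \<le> \<bar>\<Sum>X\<in>Pow I. if e \<in> X then F X else - F X\<bar>"
  shows "sum F (Pow I) \<le> a * 2 ^ card I * exp (- (\<eta>\<^sup>2 / 4) * real (card B))"
proof -
  define b where "b = real (card B)"
  define t where "t = sum F (Pow I)"
  define D where "D e = (\<Sum>X\<in>Pow I. if e \<in> X then F X else - F X)" for e
  define s :: "'a \<Rightarrow> real" where "s e = (if 0 \<le> D e then 1 else - 1)" for e
  define Y where "Y X = (\<Sum>e\<in>B. if e \<in> X then s e else - s e)" for X
  \<comment> \<open>This \<open>x\<close> minimizes the final exponent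
    \<open>x\<^sup>2 * b - x * \<eta> * b\<close>, with minimum
    \<open>- (\<eta>\<^sup>2 / 4) * b\<close>.\<close>
  define x where "x = \<eta> / 2"
  define z where "z = \<eta>\<^sup>2 / 2 * b"
  have a: "0 \<le> a" using F[of "{}"] by simp
  have "\<eta> * t * b \<le> (\<Sum>e\<in>B. \<bar>D e\<bar>)"
    using sum_bounded_below[of B "\<eta> * t" "\<lambda>e. \<bar>D e\<bar>"] biased
    by (simp add: t_def b_def D_def mult.commute)
  also have "\<dots> = (\<Sum>e\<in>B. s e * D e)" by (intro sum.cong) (auto simp: s_def)
  also have "\<dots> = (\<Sum>e\<in>B. \<Sum>X\<in>Pow I. F X * (if e \<in> X then s e else - s e))"
    unfolding D_def sum_distrib_left by (intro sum.cong) auto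
  also have "\<dots> = (\<Sum>X\<in>Pow I. F X * Y X)"
    unfolding Y_def sum_distrib_left by (rule sum.swap)
  finally have FY: "\<eta> * t * b \<le> (\<Sum>X\<in>Pow I. F X * Y X)" .
  have "x * (\<eta> * t * b) \<le> x * (\<Sum>X\<in>Pow I. F X * Y X)"
    using FY \<eta> by (intro mult_left_mono) (simp_all add: x_def)
  then have FY2: "z * t \<le> x * (\<Sum>X\<in>Pow I. F X * Y X)"
    by (simp add: x_def z_def power2_eq_square mult_ac)
  \<comment> \<open>Jensen's inequality by means of the tangent to \<open>exp\<close> at
    \<open>z\<close>: the \<open>F\<close>-weighted average of \<open>x * Y X\<close> is at least
    \<open>z\<close>.\<close>
  have "exp z * t \<le> exp z * (t + (x * (\<Sum>X\<in>Pow I. F X * Y X) - z * t))"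
    using FY2 by (intro mult_left_mono) simp_all
  also have "\<dots> = (\<Sum>X\<in>Pow I. F X * (exp z * (1 + (x * Y X - z))))"
    by (simp add: t_def algebra_simps sum.distrib sum_subtractf sum_distrib_left)
  also have "\<dots> \<le> (\<Sum>X\<in>Pow I. a * exp (x * Y X))"
  proof (rule sum_mono)
    fix X assume X: "X \<in> Pow I"
    have "exp z * (1 + (x * Y X - z)) \<le> exp z * exp (x * Y X - z)"
      by (intro mult_left_mono exp_ge_add_one_self) simp
    also have "\<dots> = exp (x * Y X)" by (simp flip: exp_add)
    finally have "F X * (exp z * (1 + (x * Y X - z))) \<le> F X * exp (x * Y X)"
      using F(1)[of X] X by (intro mult_left_mono) auto
    also have "\<dots> \<le> a * exp (x * Y X)" using F(2)[of X] X by (intro mult_right_mono) auto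
    finally show "F X * (exp z * (1 + (x * Y X - z))) \<le> a * exp (x * Y X)" .
  qed
  also have "\<dots> = a * (\<Sum>X\<in>Pow I. exp (x * Y X))" by (simp add: sum_distrib_left)
  also have "\<dots> \<le> a * (2 ^ card I * exp (x\<^sup>2 * b))"
    unfolding Y_def b_def using I \<eta> a
    by (intro mult_left_mono sum_Pow_exp_signs_le) (auto simp: x_def s_def)
  finally have "exp (- z) * (exp z * t) \<le> exp (- z) * (a * (2 ^ card I * exp (x\<^sup>2 * b)))"
    by (intro mult_left_mono) simp_all
  moreover have "exp (- z) * (exp z * t) = t"
    by (simp add: exp_minus)
  moreover have "exp (- z) * (a * (2 ^ card I * exp (x\<^sup>2 * b))) = a * 2 ^ card I * exp (x\<^sup>2 * b - z)"
    by (simp add: exp_diff exp_minus field_simps)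
  moreover have "x\<^sup>2 * b - z = - (\<eta>\<^sup>2 / 4) * b"
    by (simp add: x_def z_def power2_eq_square field_simps)
  ultimately have "t \<le> a * 2 ^ card I * exp (- (\<eta>\<^sup>2 / 4) * b)" by metis
  then show ?thesis unfolding t_def b_def .
qed

definition sum_out :: "nat \<Rightarrow> (nat set \<Rightarrow> real) \<Rightarrow> nat \<Rightarrow> real" where
  "sum_out m F j = (\<Sum>X | X \<subseteq> {..m} \<and> j \<notin> X. F X)"

definition sum_in :: "nat \<Rightarrow> (nat set \<Rightarrow> real) \<Rightarrow> nat \<Rightarrow> real" where
  "sum_in m F j = (\<Sum>X | X \<subseteq> {..m} \<and> j \<in> X. F X)"

text \<open>The tolerance 1/100 bounds the ratio of the two halves by 101/99. It is small enough
  that 2/5 times the square of this ratio, divided by 94/100, stays below 1/2.\<close>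

definition unbalanced :: "nat \<Rightarrow> (nat set \<Rightarrow> real) \<Rightarrow> nat \<Rightarrow> bool" where
  "unbalanced m F j \<longleftrightarrow>
     \<bar>sum_in m F j - sum_out m F j\<bar> > (sum_in m F j + sum_out m F j) / 100"

lemma sum_in_plus_sum_out: "sum_in m F j + sum_out m F j = sum F (Pow {..m})"
proof -
  have "Pow {..m} = {X. X \<subseteq> {..m} \<and> j \<in> X} \<union> {X. X \<subseteq> {..m} \<and> j \<notin> X}" by auto
  then show ?thesis
    unfolding sum_in_def sum_out_def
    by (subst sum.union_disjoint[symmetric]) (auto intro: finite_subset[of _ "Pow {..m}"])
qed

lemma sum_in_minus_sum_out:
  "sum_in m F j - sum_out m F j = (\<Sum>X\<in>Pow {..m}. if j \<in> X then F X else - F X)"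
proof -
  have "Pow {..m} \<inter> {X. j \<in> X} = {X. X \<subseteq> {..m} \<and> j \<in> X}"
    "Pow {..m} \<inter> - {X. j \<in> X} = {X. X \<subseteq> {..m} \<and> j \<notin> X}"
    by auto
  then show ?thesis
    by (simp add: sum.If_cases sum_in_def sum_out_def sum_negf)
qed

text \<open>The bound of \<open>biased_coordinates_bound\<close> for \<open>a = 1\<close>, bias
  1/100 and a hundredth of the \<open>m + 1\<close> coordinates biased: the rate is (1/100)^2 / 4 *
  1/100.\<close>

definition bias_error :: "nat \<Rightarrow> real" where
  "bias_error m = 2 ^ (m + 1) * exp (- real (m + 1) / 4000000)"

text \<open>If more than a hundredth of the coordinates are unbalanced, the total weight
  \<open>t\<close> is itself tiny. Otherwise they carry at most \<open>t\<close> each, while each of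
  the others carries at least \<open>99 / 200 * t\<close>; 3/100 generously bounds the resulting
  proportion.\<close>

lemma unbalanced_sum_le:
  fixes F :: "nat set \<Rightarrow> real"
  assumes F: "\<And>X. X \<subseteq> {..m} \<Longrightarrow> 0 \<le> F X" "\<And>X. X \<subseteq> {..m} \<Longrightarrow> F X \<le> a"
  shows "(\<Sum>j\<le>m. if unbalanced m F j then sum_out m F j else 0)
    \<le> 3 / 100 * (\<Sum>j\<le>m. sum_out m F j) + real (m + 1) * (a * bias_error m)"
proof -
  define t where "t = sum F (Pow {..m})"
  define B where "B = {j\<in>{..m}. unbalanced m F j}"
  define b where "b = card B"
  have a: "0 \<le> a" using F[of "{}"] by simp
  have out: "0 \<le> sum_out m F j" for j unfolding sum_out_def by (intro sum_nonneg F(1)) auto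
  have inn: "0 \<le> sum_in m F j" for j unfolding sum_in_def by (intro sum_nonneg F(1)) auto
  have tot: "sum_in m F j + sum_out m F j = t" for j
    unfolding t_def by (rule sum_in_plus_sum_out)
  have out_le: "sum_out m F j \<le> t" for j using tot[of j] inn[of j] by linarith
  have t0: "0 \<le> t" using out[of 0] out_le[of 0] by linarith
  have bad: "(\<Sum>j\<le>m. if unbalanced m F j then sum_out m F j else 0) = (\<Sum>j\<in>B. sum_out m F j)"
    unfolding B_def by (subst sum.inter_filter) simp_all
  have "(\<Sum>j\<in>B. sum_out m F j) \<le> real b * t"
    unfolding b_def by (rule sum_bounded_above) (rule out_le)
  note bad_le = this
  have b_le: "b \<le> m + 1" unfolding b_def B_def
    using card_mono[of "{..m}" "{j\<in>{..m}. unbalanced m F j}"] by auto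
  have out_sum: "0 \<le> (\<Sum>j\<le>m. sum_out m F j)" by (intro sum_nonneg out)
  have e0: "0 \<le> a * bias_error m" using a by (simp add: bias_error_def)
  show ?thesis
  proof (cases "100 * b > m + 1")
    case True
    have "t \<le> a * 2 ^ card {..m} * exp (- ((1 / 100)\<^sup>2 / 4) * real (card B))"
      unfolding t_def
    proof (rule biased_coordinates_bound)
      fix e assume "e \<in> B"
      then have "unbalanced m F e" by (simp add: B_def)
      then show "1 / 100 * sum F (Pow {..m}) \<le> \<bar>\<Sum>X\<in>Pow {..m}. if e \<in> X then F X else - F X\<bar>"
        unfolding unbalanced_def sum_in_minus_sum_out sum_in_plus_sum_out by simp
    qed (use F in \<open>auto simp: B_def\<close>)
    also have "\<dots> \<le> a * 2 ^ card {..m} * exp (- real (m + 1) / 4000000)"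
      using True a by (intro mult_left_mono) (auto simp: b_def power2_eq_square)
    also have "\<dots> = a * bias_error m" by (simp add: bias_error_def)
    finally have t: "t \<le> a * bias_error m" .
    have "real b * t \<le> real (m + 1) * (a * bias_error m)"
      using b_le t t0 by (intro mult_mono) auto
    then show ?thesis using bad bad_le out_sum by linarith
  next
    case False
    have good: "99 / 200 * t \<le> sum_out m F j" if "j \<in> {..m} - B" for j
    proof -
      have "\<bar>sum_in m F j - sum_out m F j\<bar> \<le> t / 100"
        using that tot[of j] by (auto simp: B_def unbalanced_def)
      then show ?thesis using tot[of j] by linarith
    qed
    have BI: "B \<subseteq> {..m}" by (auto simp: B_def)
    have card_good: "real (card ({..m} - B)) = real (m + 1) - real b"
      using BI b_le by (simp add: card_Diff_subset finite_subset b_def of_nat_diff)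
    have "(real (m + 1) - real b) * (99 / 200 * t) \<le> (\<Sum>j\<in>{..m} - B. sum_out m F j)"
      unfolding card_good[symmetric] using good by (intro sum_bounded_below) auto
    also have "\<dots> \<le> (\<Sum>j\<le>m. sum_out m F j)"
      by (intro sum_mono2) (auto intro: out)
    finally have 1: "(real (m + 1) - real b) * (99 / 200 * t) \<le> (\<Sum>j\<le>m. sum_out m F j)" .
    have bm: "real b \<le> real (m + 1) / 100"
      using False of_nat_mono[of "100 * b" "m + 1", where ?'a = real] by simp
    then have "99 / 100 * real (m + 1) * (99 / 200 * t) \<le> (real (m + 1) - real b) * (99 / 200 * t)"
      using t0 by (intro mult_right_mono) auto
    moreover have "real b * t \<le> real (m + 1) / 100 * t"
      using bm t0 by (rule mult_right_mono)
    moreover have "0 \<le> real (m + 1) * t" using t0 by simp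
    ultimately have "real b * t \<le> 3 / 100 * (\<Sum>j\<le>m. sum_out m F j)"
      using 1 by (simp add: field_simps)
    moreover have "0 \<le> real (m + 1) * (a * bias_error m)" using e0 by simp
    ultimately show ?thesis using bad bad_le by linarith
  qed
qed

lemma sum_out_transpose:
  assumes "j \<le> m"
  shows "sum_out m (\<lambda>X. F (Transposition.transpose 0 j ` X)) 0 = sum_out m F j"
    and "sum_in m (\<lambda>X. F (Transposition.transpose 0 j ` X)) 0 = sum_in m F j"
proof -
  let ?t = "(`) (Transposition.transpose 0 j) :: nat set \<Rightarrow> nat set"
  have inv: "?t (?t X) = X" for X by (simp add: image_image)
  have sub: "?t X \<subseteq> {..m} \<longleftrightarrow> X \<subseteq> {..m}" for X
  proof -
    have *: "?t X \<subseteq> {..m}" if "X \<subseteq> {..m}" for X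
      using that assms by (auto simp: Transposition.transpose_def)
    show ?thesis using *[of X] *[of "?t X"] inv by auto
  qed
  have mem: "0 \<in> ?t X \<longleftrightarrow> j \<in> X" "j \<in> ?t X \<longleftrightarrow> 0 \<in> X" for X
    by (auto simp: Transposition.transpose_def image_iff split: if_splits)
  show "sum_out m (\<lambda>X. F (?t X)) 0 = sum_out m F j"
    unfolding sum_out_def
    by (rule sum.reindex_bij_witness[of _ ?t ?t]) (auto simp: inv sub mem simp del: image_subset_iff)
  show "sum_in m (\<lambda>X. F (?t X)) 0 = sum_in m F j"
    unfolding sum_in_def
    by (rule sum.reindex_bij_witness[of _ ?t ?t]) (auto simp: inv sub mem simp del: image_subset_iff)
qed

text \<open>Composition with \<open>\<theta> j\<close> permutes the summation range and turns
  coordinate 0 into coordinate \<open>j\<close>. Averaging over \<open>j\<close> thus replaces the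
  event that coordinate 0 is unbalanced by the share of all unbalanced coordinates. The factor
  \<open>h\<close> stands for the weight of the opposite side.\<close>

lemma unbalanced_average_le:
  fixes F :: "('a \<Rightarrow> 'a) \<Rightarrow> nat set \<Rightarrow> real" and h :: "('a \<Rightarrow> 'a) \<Rightarrow> real"
  assumes \<theta>: "\<And>j. j \<le> m \<Longrightarrow> \<theta> j permutes S"
    and F: "\<And>p X. p permutes S \<Longrightarrow> X \<subseteq> {..m} \<Longrightarrow> 0 \<le> F p X"
      "\<And>p X. p permutes S \<Longrightarrow> X \<subseteq> {..m} \<Longrightarrow> F p X \<le> a"
    and sym: "\<And>p j X. p permutes S \<Longrightarrow> j \<le> m \<Longrightarrow> X \<subseteq> {..m} \<Longrightarrow>
        F (p \<circ> \<theta> j) X = F p (Transposition.transpose 0 j ` X)"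
    and h: "\<And>p. p permutes S \<Longrightarrow> 0 \<le> h p"
      "\<And>p j. p permutes S \<Longrightarrow> j \<le> m \<Longrightarrow> h (p \<circ> \<theta> j) = h p"
  shows "(\<Sum>p | p permutes S. if unbalanced m (F p) 0 then h p * sum_out m (F p) 0 else 0)
    \<le> 3 / 100 * (\<Sum>p | p permutes S. h p * sum_out m (F p) 0)
      + a * bias_error m * (\<Sum>p | p permutes S. h p)"
proof -
  let ?P = "{p. p permutes S}"
  have out: "sum_out m (F (p \<circ> \<theta> j)) 0 = sum_out m (F p) j"
    "sum_in m (F (p \<circ> \<theta> j)) 0 = sum_in m (F p) j" if "p \<in> ?P" "j \<le> m" for p j
  proof -
    have "sum_out m (F (p \<circ> \<theta> j)) 0 = sum_out m (\<lambda>X. F p (Transposition.transpose 0 j ` X)) 0"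
      unfolding sum_out_def using that sym by (intro sum.cong) auto
    then show "sum_out m (F (p \<circ> \<theta> j)) 0 = sum_out m (F p) j"
      using sum_out_transpose(1)[OF that(2)] by simp
    have "sum_in m (F (p \<circ> \<theta> j)) 0 = sum_in m (\<lambda>X. F p (Transposition.transpose 0 j ` X)) 0"
      unfolding sum_in_def using that sym by (intro sum.cong) auto
    then show "sum_in m (F (p \<circ> \<theta> j)) 0 = sum_in m (F p) j"
      using sum_out_transpose(2)[OF that(2)] by simp
  qed
  have bal: "unbalanced m (F (p \<circ> \<theta> j)) 0 \<longleftrightarrow> unbalanced m (F p) j"
    if "p \<in> ?P" "j \<le> m" for p j
    using out[OF that] by (simp add: unbalanced_def)
  define G where "G p = (if unbalanced m (F p) 0 then h p * sum_out m (F p) 0 else 0)" for p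
  define H where "H p = h p * sum_out m (F p) 0" for p
  have avg: "real (m + 1) * sum K ?P = (\<Sum>p\<in>?P. \<Sum>j\<le>m. K (p \<circ> \<theta> j))" for K :: "_ \<Rightarrow> real"
  proof -
    have shift: "sum K ?P = (\<Sum>p\<in>?P. K (p \<circ> \<theta> j))" if "j \<in> {..m}" for j
      using that by (intro sum_permutations_compose_right \<theta>) simp
    have "(\<Sum>j\<le>m. sum K ?P) = (\<Sum>j\<le>m. \<Sum>p\<in>?P. K (p \<circ> \<theta> j))"
      by (rule sum.cong[OF refl]) (rule shift)
    also have "\<dots> = (\<Sum>p\<in>?P. \<Sum>j\<le>m. K (p \<circ> \<theta> j))" by (rule sum.swap)
    finally show ?thesis by simp
  qed
  have "real (m + 1) * sum G ?P = (\<Sum>p\<in>?P. \<Sum>j\<le>m. G (p \<circ> \<theta> j))" by (rule avg)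
  also have "\<dots> = (\<Sum>p\<in>?P. h p * (\<Sum>j\<le>m. if unbalanced m (F p) j then sum_out m (F p) j else 0))"
    unfolding sum_distrib_left
    by (intro sum.cong) (auto simp: G_def bal out h)
  also have "\<dots> \<le> (\<Sum>p\<in>?P. h p * (3 / 100 * (\<Sum>j\<le>m. sum_out m (F p) j) + real (m + 1) * (a * bias_error m)))"
    using F h by (intro sum_mono mult_left_mono unbalanced_sum_le) auto
  also have "\<dots> = (\<Sum>p\<in>?P. 3 / 100 * (\<Sum>j\<le>m. H (p \<circ> \<theta> j)) + real (m + 1) * (a * bias_error m * h p))"
    by (intro sum.cong) (auto simp: H_def out h sum_distrib_left algebra_simps)
  also have "\<dots> = 3 / 100 * (\<Sum>p\<in>?P. \<Sum>j\<le>m. H (p \<circ> \<theta> j)) + real (m + 1) * (a * bias_error m * sum h ?P)"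
    by (simp add: sum.distrib sum_distrib_left)
  also have "\<dots> = real (m + 1) * (3 / 100 * sum H ?P + a * bias_error m * sum h ?P)"
    unfolding avg[symmetric] by (simp add: algebra_simps)
  finally have "sum G ?P \<le> 3 / 100 * sum H ?P + a * bias_error m * sum h ?P"
    by (subst (asm) mult_le_cancel_left_pos) simp_all
  then show ?thesis by (simp add: G_def H_def)
qed

section \<open>Labellings and matchings\<close>

text \<open>
  The pair \<open>(S, T)\<close> of disjoint vertex numbers encodes the labelling of \<open>U\<close> by \<open>S \<union> T\<close> and of \<open>V\<close>
  by \<open>T\<close>. A red edge wants different labels at its ends and a blue edge equal ones.
\<close>

fun mismatched :: "nat set \<times> nat set \<Rightarrow> edge \<Rightarrow> bool" where
  "mismatched (S, T) (u, v, c) \<longleftrightarrow> (c = Red) \<noteq> ((u \<in> S \<union> T) \<noteq> (v \<in> T))"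

lemma perfect_matching_bij:
  assumes "perfect_matching n M"
  shows "bij_betw fst M {..<n}" "bij_betw (\<lambda>e. fst (snd e)) M {..<n}"
proof -
  have M: "M \<subseteq> edges n" "\<And>u. u < n \<Longrightarrow> \<exists>!e. e \<in> M \<and> fst e = u"
    "\<And>v. v < n \<Longrightarrow> \<exists>!e. e \<in> M \<and> fst (snd e) = v"
    using assms by (simp_all add: perfect_matching_def)
  have less: "fst e < n" "fst (snd e) < n" if "e \<in> M" for e
    using that M(1) by (auto simp: edges_def)
  show "bij_betw fst M {..<n}"
    unfolding bij_betw_def
  proof (intro conjI inj_onI equalityI subsetI)
    show "e = e'" if "e \<in> M" "e' \<in> M" "fst e = fst e'" for e e'
      using M(2)[OF less(1)[OF that(1)]] that by metis
    show "u \<in> fst ` M" if "u \<in> {..<n}" for u using M(2)[of u] that by blast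
  qed (use less in auto)
  show "bij_betw (\<lambda>e. fst (snd e)) M {..<n}"
    unfolding bij_betw_def
  proof (intro conjI inj_onI equalityI subsetI)
    show "e = e'" if "e \<in> M" "e' \<in> M" "fst (snd e) = fst (snd e')" for e e'
      using M(3)[OF less(2)[OF that(1)]] that by metis
    show "u \<in> (\<lambda>e. fst (snd e)) ` M" if "u \<in> {..<n}" for u using M(3)[of u] that by blast
  qed (use less in auto)
qed

lemma finite_odd_perfect_matchings: "finite (odd_perfect_matchings n)"
proof (rule finite_subset)
  show "odd_perfect_matchings n \<subseteq> Pow (edges n)"
    by (auto simp: odd_perfect_matchings_def perfect_matching_def)
  show "finite (Pow (edges n))" by (simp add: edges_def)
qed

text \<open>For each edge, the indicators of being mismatched and of being red plus the labels of
  the two ends have an even sum. Over a perfect matching the labels add up to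
  \<open>card S + 2 * card T\<close>.\<close>

lemma card_mismatched_odd:
  assumes M: "M \<in> odd_perfect_matchings n"
    and r: "S \<subseteq> {..<n}" "T \<subseteq> {..<n}" "S \<inter> T = {}" "even (card S)"
  shows "odd (card {e \<in> M. mismatched (S, T) e})"
proof -
  have pm: "perfect_matching n M" and red: "odd (card {e \<in> M. snd (snd e) = Red})"
    using M by (auto simp: odd_perfect_matchings_def)
  have "finite (edges n)" by (simp add: edges_def)
  then have fin: "finite M"
    using pm by (auto simp: perfect_matching_def intro: finite_subset)
  have cnt: "card {e \<in> M. P e} = (\<Sum>e\<in>M. of_bool (P e))" for P :: "edge \<Rightarrow> bool"
    using fin by (simp add: sum_of_bool_eq Int_def)
  have card_pre: "card {e \<in> M. f e \<in> A} = card A"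
    if "bij_betw f M {..<n}" "A \<subseteq> {..<n}" for f and A :: "nat set"
  proof (rule bij_betw_same_card)
    show "bij_betw f {e \<in> M. f e \<in> A} A"
    proof (rule bij_betw_imageI)
      show "inj_on f {e \<in> M. f e \<in> A}"
        using that by (auto simp: bij_betw_def intro: inj_on_subset)
      have "A \<subseteq> f ` M" using that by (simp add: bij_betw_def)
      then show "f ` {e \<in> M. f e \<in> A} = A" by blast
    qed
  qed
  have "even (\<Sum>e\<in>M. of_bool (mismatched (S, T) e) + of_bool (snd (snd e) = Red)
      + of_bool (fst e \<in> S \<union> T) + of_bool (fst (snd e) \<in> T) :: nat)"
  proof (rule dvd_sum)
    fix e assume "e \<in> M"
    obtain u v c where "e = (u, v, c)" by (cases e)
    then show "even (of_bool (mismatched (S, T) e) + of_bool (snd (snd e) = Red)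
      + of_bool (fst e \<in> S \<union> T) + of_bool (fst (snd e) \<in> T) :: nat)"
      by auto
  qed
  then have "even (card {e \<in> M. mismatched (S, T) e} + card {e \<in> M. snd (snd e) = Red}
      + card {e \<in> M. fst e \<in> S \<union> T} + card {e \<in> M. fst (snd e) \<in> T})"
    unfolding cnt by (simp add: sum.distrib)
  moreover have "card {e \<in> M. fst e \<in> S \<union> T} = card S + card T"
    using card_pre[OF perfect_matching_bij(1)[OF pm], of "S \<union> T"] r
    by (simp add: card_Un_disjoint finite_subset)
  moreover have "card {e \<in> M. fst (snd e) \<in> T} = card T"
    using card_pre[OF perfect_matching_bij(2)[OF pm], of T] r by simp
  ultimately show ?thesis using red r by presburger
qed

text \<open>\<open>J\<close> holds the 2-cycles of an involution of \<open>{..<n}\<close>, each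
  written in one of its two orders, and \<open>z\<close> is one of the fixed points.\<close>

definition pairing :: "nat \<Rightarrow> nat \<Rightarrow> (nat \<times> nat) set \<Rightarrow> bool" where
  "pairing n z J \<longleftrightarrow> J \<subseteq> {..<n} \<times> {..<n} \<and> single_valued J \<and> single_valued (J\<inverse>) \<and>
     Domain J \<inter> Range J = {} \<and> z \<notin> Field J \<and> z < n"

text \<open>The graph of that involution, with the 2-cycles and the loop at \<open>z\<close> red and
  the other loops blue.\<close>

definition matching :: "nat \<Rightarrow> nat \<Rightarrow> (nat \<times> nat) set \<Rightarrow> edge set" where
  "matching n z J = {(i, j, c).
     (c = Red \<and> ((i, j) \<in> J \<or> (j, i) \<in> J \<or> i = z \<and> j = z)) \<or>
     (c = Blue \<and> i = j \<and> i < n \<and> i \<notin> Field J \<and> i \<noteq> z)}"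

lemma matching_iff:
  "(i, j, c) \<in> matching n z J \<longleftrightarrow>
     (c = Red \<and> ((i, j) \<in> J \<or> (j, i) \<in> J \<or> i = z \<and> j = z)) \<or>
     (c = Blue \<and> i = j \<and> i < n \<and> i \<notin> Field J \<and> i \<noteq> z)"
  by (simp add: matching_def)

lemma matching_ex1:
  assumes J: "pairing n z J" and u: "u < n"
  shows "\<exists>!e. e \<in> matching n z J \<and> fst e = u" "\<exists>!e. e \<in> matching n z J \<and> fst (snd e) = u"
proof -
  have J': "single_valued J" "single_valued (J\<inverse>)" "Domain J \<inter> Range J = {}" "z \<notin> Field J"
    using J by (auto simp: pairing_def)
  obtain v c where vc: "(u, v, c) \<in> matching n z J" "(v, u, c) \<in> matching n z J"
    "\<And>v' c'. (u, v', c') \<in> matching n z J \<Longrightarrow> v' = v \<and> c' = c"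
    "\<And>v' c'. (v', u, c') \<in> matching n z J \<Longrightarrow> v' = v \<and> c' = c"
  proof (cases "u \<in> Field J")
    case True
    then consider v where "(u, v) \<in> J" | v where "(v, u) \<in> J" by (auto simp: Field_def)
    then show ?thesis
    proof cases
      case (1 v)
      show ?thesis
        by (rule that[of v Red])
          (use 1 J' in \<open>auto simp: matching_iff Field_def single_valued_def Domain_iff Range_iff\<close>)
    next
      case (2 v)
      show ?thesis
        by (rule that[of v Red])
          (use 2 J' in \<open>auto simp: matching_iff Field_def single_valued_def Domain_iff Range_iff\<close>)
    qed
  next
    case False
    show ?thesis
      by (rule that[of u "if u = z then Red else Blue"])
        (use False u in \<open>auto simp: matching_iff Field_def split: if_splits\<close>)
  qed
  show "\<exists>!e. e \<in> matching n z J \<and> fst e = u"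
  proof (rule ex1I[of _ "(u, v, c)"])
    fix e assume "e \<in> matching n z J \<and> fst e = u"
    then show "e = (u, v, c)" using vc(3)[of "fst (snd e)" "snd (snd e)"] by (cases e) simp
  qed (use vc(1) in simp)
  show "\<exists>!e. e \<in> matching n z J \<and> fst (snd e) = u"
  proof (rule ex1I[of _ "(v, u, c)"])
    fix e assume "e \<in> matching n z J \<and> fst (snd e) = u"
    then show "e = (v, u, c)" using vc(4)[of "fst e" "snd (snd e)"] by (cases e) simp
  qed (use vc(2) in simp)
qed

text \<open>Each pair of \<open>J\<close> yields two red edges, and the loop at \<open>z\<close>
  adds one.\<close>

lemma matching_odd:
  assumes J: "pairing n z J"
  shows "matching n z J \<in> odd_perfect_matchings n"
proof -
  have J': "J \<subseteq> {..<n} \<times> {..<n}" "Domain J \<inter> Range J = {}" "z \<notin> Field J" "z < n"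
    using J by (auto simp: pairing_def)
  have fin: "finite J" using J'(1) by (rule finite_subset) simp
  have "matching n z J \<subseteq> edges n"
  proof
    fix e assume "e \<in> matching n z J"
    moreover obtain i j c where "e = (i, j, c)" by (cases e)
    ultimately show "e \<in> edges n" using J' by (cases c) (auto simp: matching_iff edges_def)
  qed
  then have pm: "perfect_matching n (matching n z J)"
    using matching_ex1[OF J] by (simp add: perfect_matching_def)
  define g where "g = (\<lambda>p. (fst p, snd p, Red) :: edge)"
  have "{e \<in> matching n z J. snd (snd e) = Red} = g ` insert (z, z) (J \<union> J\<inverse>)"
  proof (intro set_eqI)
    fix e :: edge
    obtain i j c where e: "e = (i, j, c)" by (cases e)
    have gA: "e \<in> g ` A \<longleftrightarrow> c = Red \<and> (i, j) \<in> A" for A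
      unfolding e g_def by force
    show "e \<in> {e \<in> matching n z J. snd (snd e) = Red} \<longleftrightarrow>
        e \<in> g ` insert (z, z) (J \<union> J\<inverse>)"
      unfolding gA mem_Collect_eq unfolding e matching_iff by auto
  qed
  moreover have "inj g" by (auto simp: g_def inj_def prod_eq_iff)
  ultimately have "card {e \<in> matching n z J. snd (snd e) = Red} = card (insert (z, z) (J \<union> J\<inverse>))"
    by (metis card_image inj_on_subset subset_UNIV)
  also have "\<dots> = Suc (card (J \<union> J\<inverse>))"
    using fin J'(3) by (subst card_insert_disjoint) (auto simp: Field_def)
  also have "card (J \<union> J\<inverse>) = card J + card (J\<inverse>)"
    using fin J'(2) by (intro card_Un_disjoint) auto
  also have "card (J\<inverse>) = card J" by (rule card_inverse)
  finally show ?thesis using pm by (simp add: odd_perfect_matchings_def)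
qed

text \<open>A vertex number in \<open>S\<close> has label 1 in \<open>U\<close> and 0 in
  \<open>V\<close>; the others have equal labels on both sides. So a red swap is satisfied by two
  members of \<open>S\<close>, or by two non-members with different labels, and only the blue loops
  at members of \<open>S\<close> fail.\<close>

lemma mismatched_matching:
  assumes "S \<inter> T = {}" "z \<in> S" "S \<subseteq> {..<n}"
    and "\<And>i j. (i, j) \<in> J \<Longrightarrow> i \<in> S \<and> j \<in> S \<or> i \<notin> S \<and> j \<notin> S \<and> (i \<in> T) \<noteq> (j \<in> T)"
  shows "{e \<in> matching n z J. mismatched (S, T) e} = (\<lambda>i. (i, i, Blue)) ` (S - Field J - {z})"
proof (intro set_eqI)
  fix e :: edge
  obtain i j c where e: "e = (i, j, c)" by (cases e)
  have "i \<in> S \<Longrightarrow> i \<notin> T" for i using assms(1) by blast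
  then show "e \<in> {e \<in> matching n z J. mismatched (S, T) e} \<longleftrightarrow>
      e \<in> (\<lambda>i. (i, i, Blue)) ` (S - Field J - {z})"
    unfolding e using assms(2,3) assms(4)[of i j] assms(4)[of j i]
    by (auto simp: matching_iff)
qed

lemma pairing_permute:
  assumes p: "p permutes {..<n}" and J: "pairing n z J"
  shows "pairing n (p z) (map_prod p p ` J)"
proof -
  have inj: "p x = p y \<longleftrightarrow> x = y" for x y using permutes_inj[OF p] by (auto simp: inj_def)
  have less: "p x < n \<longleftrightarrow> x < n" for x using permutes_in_image[OF p] by simp
  show ?thesis
    using J unfolding pairing_def single_valued_def Field_def
    by (auto simp: inj less) blast+
qed

section \<open>The hard rows and columns\<close>

text \<open>
  Vertex numbers below \<open>5\<close> are the core, \<open>4 * m + 5\<close> is the vertex with a red loop that makes the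
  number of red edges odd, and the numbers in between form \<open>m\<close> pairs \<open>pair 3 t j\<close>, which are free in
  the row and swapped in the column, and \<open>m\<close> pairs \<open>pair (2 * m + 3) t j\<close>, which are free in the
  column and not starred in the row. The pair with index \<open>0\<close> consists of two cyclically adjacent
  core vertices, selected by \<open>t\<close>. In a row, \<open>X\<close> lists the pairs that are starred (different labels
  in \<open>U\<close> and \<open>V\<close>); in a column, \<open>Y\<close> lists the pairs that consist of two blue loops instead of a
  red swap.
\<close>

definition pair :: "nat \<Rightarrow> nat \<Rightarrow> nat \<Rightarrow> nat \<times> nat" where
  "pair s t j = (if j = 0 then (t, Suc t mod 5) else (s + 2 * j, Suc (s + 2 * j)))"

definition star :: "nat \<Rightarrow> nat \<Rightarrow> nat set \<Rightarrow> nat set" where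
  "star m t X = insert (4 * m + 5) ({..<5} - {t, Suc t mod 5})
     \<union> fst ` pair 3 t ` X \<union> snd ` pair 3 t ` X"

text \<open>In an unstarred pair the second vertex has label 1 on both sides and the first has label
  0, so that the pair accepts a red swap as well as two blue loops.\<close>

definition ones :: "nat \<Rightarrow> nat \<Rightarrow> nat set \<Rightarrow> nat set" where
  "ones m t X = snd ` pair 3 t ` ({..m} - X) \<union> snd ` pair (2 * m + 3) t ` {1..m}"

definition swaps :: "nat \<Rightarrow> nat \<Rightarrow> nat set \<Rightarrow> (nat \<times> nat) set" where
  "swaps m t Y = pair (2 * m + 3) t ` ({..m} - Y) \<union> pair 3 t ` {1..m}"

lemma Suc_mod_5: "t < 5 \<Longrightarrow> Suc t mod 5 < 5 \<and> Suc t mod 5 \<noteq> t"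
  by (cases "t = 4") auto

lemma swaps_cases:
  assumes "(i, j) \<in> swaps m t Y"
  obtains "0 \<notin> Y" "i = t" "j = Suc t mod 5"
  | k where "k \<in> {1..m}" "k \<notin> Y" "i = 2 * m + 3 + 2 * k" "j = 2 * m + 4 + 2 * k"
  | k where "k \<in> {1..m}" "i = 3 + 2 * k" "j = 4 + 2 * k"
proof -
  from assms consider k where "k \<le> m" "k \<notin> Y" "(i, j) = pair (2 * m + 3) t k"
    | k where "k \<in> {1..m}" "(i, j) = pair 3 t k"
    by (auto simp: swaps_def)
  then show ?thesis
  proof cases
    case (1 k)
    then show ?thesis using that(1) that(2)[of k] by (cases "k = 0") (auto simp: pair_def)
  next
    case (2 k)
    then show ?thesis using that(3)[of k] by (auto simp: pair_def)
  qed
qed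

lemma pairing_swaps:
  assumes t: "t < 5" and n: "4 * m + 6 \<le> n"
  shows "pairing n (4 * m + 5) (swaps m t Y)"
proof -
  define t' where "t' = Suc t mod 5"
  have t': "t' < 5" "t' \<noteq> t" using Suc_mod_5[OF t] by (simp_all add: t'_def)
  \<comment> \<open>Apart from the core pair, every swap joins an odd number from 5 on to its
    successor; all disjointness claims follow from this.\<close>
  have c: "i = t \<and> j = t' \<or> odd i \<and> 5 \<le> i \<and> i < 4 * m + 5 \<and> j = Suc i \<and> j < 4 * m + 5"
    if "(i, j) \<in> swaps m t Y" for i j
    using that by (rule swaps_cases) (auto simp: t'_def)
  have "swaps m t Y \<subseteq> {..<n} \<times> {..<n}"
  proof
    fix x assume "x \<in> swaps m t Y"
    then show "x \<in> {..<n} \<times> {..<n}" using c[of "fst x" "snd x"] t t' n by (cases x) auto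
  qed
  moreover have "single_valued (swaps m t Y)"
  proof (rule single_valuedI)
    fix i j k assume "(i, j) \<in> swaps m t Y" "(i, k) \<in> swaps m t Y"
    then show "j = k" using c[of i j] c[of i k] t t' by auto
  qed
  moreover have "single_valued ((swaps m t Y)\<inverse>)"
  proof (rule single_valuedI)
    fix i j k assume "(i, j) \<in> (swaps m t Y)\<inverse>" "(i, k) \<in> (swaps m t Y)\<inverse>"
    then show "j = k" using c[of j i] c[of k i] t t' by auto
  qed
  moreover have "Domain (swaps m t Y) \<inter> Range (swaps m t Y) = {}"
  proof (rule ccontr)
    assume "\<not> ?thesis"
    then obtain i j k where "(i, j) \<in> swaps m t Y" "(k, i) \<in> swaps m t Y" by blast
    then show False using c[of i j] c[of k i] t t' by auto
  qed
  moreover have "4 * m + 5 \<notin> Field (swaps m t Y)"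
  proof
    assume "4 * m + 5 \<in> Field (swaps m t Y)"
    then obtain j where "(4 * m + 5, j) \<in> swaps m t Y \<or> (j, 4 * m + 5) \<in> swaps m t Y"
      by (auto simp: Field_def)
    then show False using c[of "4 * m + 5" j] c[of j "4 * m + 5"] t t' by auto
  qed
  ultimately show ?thesis using n by (simp add: pairing_def)
qed

lemma pair_eqs:
  "fst (pair s t j) = (if j = 0 then t else s + 2 * j)"
  "snd (pair s t j) = (if j = 0 then Suc t mod 5 else Suc (s + 2 * j))"
  by (simp_all add: pair_def)

lemma star_mem:
  "i \<in> star m t X \<longleftrightarrow> i = 4 * m + 5 \<or> i < 5 \<and> i \<noteq> t \<and> i \<noteq> Suc t mod 5 \<or>
     0 \<in> X \<and> (i = t \<or> i = Suc t mod 5) \<or> (\<exists>k\<in>X. 0 < k \<and> (i = 3 + 2 * k \<or> i = 4 + 2 * k))"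
  by (auto simp: star_def image_image image_iff pair_eqs)

lemma ones_mem:
  assumes "X \<subseteq> {..m}"
  shows "i \<in> ones m t X \<longleftrightarrow> 0 \<notin> X \<and> i = Suc t mod 5 \<or>
     (\<exists>k\<in>{1..m}. k \<notin> X \<and> i = 4 + 2 * k) \<or> (\<exists>k\<in>{1..m}. i = 2 * m + 4 + 2 * k)"
  by (auto simp: ones_def image_image image_iff pair_eqs Bex_def)

lemma star_iff:
  assumes t: "t < 5" and X: "X \<subseteq> {..m}"
  shows "i < 5 \<Longrightarrow> i \<in> star m t X \<longleftrightarrow> 0 \<in> X \<or> i \<noteq> t \<and> i \<noteq> Suc t mod 5"
    and "k \<in> {1..m} \<Longrightarrow> 3 + 2 * k \<in> star m t X \<longleftrightarrow> k \<in> X"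
    and "k \<in> {1..m} \<Longrightarrow> 4 + 2 * k \<in> star m t X \<longleftrightarrow> k \<in> X"
    and "2 * m + 5 \<le> i \<Longrightarrow> i \<in> star m t X \<longleftrightarrow> i = 4 * m + 5"
  using Suc_mod_5[OF t] t X by (auto simp: star_mem; presburger)+

lemma ones_iff:
  assumes t: "t < 5" and X: "X \<subseteq> {..m}"
  shows "i < 5 \<Longrightarrow> i \<in> ones m t X \<longleftrightarrow> 0 \<notin> X \<and> i = Suc t mod 5"
    and "k \<in> {1..m} \<Longrightarrow> 3 + 2 * k \<notin> ones m t X"
    and "k \<in> {1..m} \<Longrightarrow> 4 + 2 * k \<in> ones m t X \<longleftrightarrow> k \<notin> X"
    and "k \<in> {1..m} \<Longrightarrow> 2 * m + 3 + 2 * k \<notin> ones m t X"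
    and "k \<in> {1..m} \<Longrightarrow> 2 * m + 4 + 2 * k \<in> ones m t X"
  using Suc_mod_5[OF t] t by (auto simp: ones_mem[OF X]; presburger)+

section \<open>Symmetries exchanging the core pair with a reserve pair\<close>

definition exchange :: "nat \<Rightarrow> nat \<Rightarrow> nat \<Rightarrow> nat \<Rightarrow> nat" where
  "exchange s t j = (if j = 0 then id else
     Transposition.transpose t (s + 2 * j) \<circ>
     Transposition.transpose (Suc t mod 5) (Suc (s + 2 * j)))"

lemma exchange_permutes:
  assumes "t < 5" "j \<le> m" "s + 2 * m + 1 < n" "4 < n"
  shows "exchange s t j permutes {..<n}"
proof -
  have "Suc t mod 5 < 5" by simp
  then show ?thesis
    using assms unfolding exchange_def
    by (auto simp: permutes_id intro!: permutes_compose permutes_swap_id)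
qed

lemma exchange_fixes:
  assumes "t < 5" "i \<noteq> t" "i \<noteq> Suc t mod 5" "i \<noteq> s + 2 * j" "i \<noteq> Suc (s + 2 * j)"
  shows "exchange s t j i = i"
  using assms by (auto simp: exchange_def Transposition.transpose_def)

text \<open>First vertices are exchanged with first and second with second, so the order within
  pairs survives; \<open>ones\<close> depends on it. The offset \<open>s\<close> is 3 for the row's
  reserve pairs and \<open>2 * m + 3\<close> for the column's.\<close>

lemma exchange_pair:
  assumes t: "t < 5" and s: "3 \<le> s"
  shows "map_prod (exchange s t j) (exchange s t j) (pair s t k) = pair s t (Transposition.transpose 0 j k)"
proof -
  define t' where "t' = Suc t mod 5"
  have t': "t' < 5" "t' \<noteq> t" using Suc_mod_5[OF t] by (simp_all add: t'_def)
  show ?thesis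
    unfolding pair_def exchange_def t'_def[symmetric] Transposition.transpose_def
    using t t' s by auto
qed

lemma exchange_pair_other:
  assumes "t < 5" "k \<in> {1..m}" "j \<le> m"
  shows "map_prod (exchange 3 t j) (exchange 3 t j) (pair (2 * m + 3) t k) = pair (2 * m + 3) t k"
    "map_prod (exchange (2 * m + 3) t j) (exchange (2 * m + 3) t j) (pair 3 t k) = pair 3 t k"
proof -
  have "Suc t mod 5 < 5" by simp
  then show "map_prod (exchange 3 t j) (exchange 3 t j) (pair (2 * m + 3) t k) = pair (2 * m + 3) t k"
    "map_prod (exchange (2 * m + 3) t j) (exchange (2 * m + 3) t j) (pair 3 t k) = pair 3 t k"
    using assms unfolding pair_def exchange_def Transposition.transpose_def by auto
qed

lemma transpose_image_atMost_Diff: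
  "j \<le> m \<Longrightarrow> Transposition.transpose 0 j ` ({..m} - X) = {..m} - Transposition.transpose 0 j ` X"
  for m :: nat
proof -
  assume j: "j \<le> m"
  have "Transposition.transpose 0 j ` {..m} = {..m}"
    using permutes_image[OF permutes_swap_id[of 0 "{..m}" j]] j by simp
  then show ?thesis by (simp add: image_set_diff)
qed

lemma exchange_pair_image:
  assumes "t < 5" "3 \<le> s"
  shows "map_prod (exchange s t j) (exchange s t j) ` pair s t ` X = pair s t ` Transposition.transpose 0 j ` X"
  unfolding image_image using exchange_pair[OF assms] by simp

lemma exchange_pair_other_image:
  assumes "t < 5" "j \<le> m" "X \<subseteq> {1..m}"
  shows "map_prod (exchange 3 t j) (exchange 3 t j) ` pair (2 * m + 3) t ` X = pair (2 * m + 3) t ` X" (is ?A)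
    and "map_prod (exchange (2 * m + 3) t j) (exchange (2 * m + 3) t j) ` pair 3 t ` X = pair 3 t ` X" (is ?B)
proof -
  show ?A
    unfolding image_image by (rule image_cong[OF refl], rule exchange_pair_other(1)) (use assms in auto)
  show ?B
    unfolding image_image by (rule image_cong[OF refl], rule exchange_pair_other(2)) (use assms in auto)
qed

lemma fst_map_prod_image: "f ` fst ` R = fst ` map_prod f f ` R"
  and snd_map_prod_image: "f ` snd ` R = snd ` map_prod f f ` R"
  by (simp_all add: image_image)

lemma exchange_star:
  assumes t: "t < 5" and j: "j \<le> m"
  shows "exchange 3 t j ` star m t X = star m t (Transposition.transpose 0 j ` X)"
proof -
  have "exchange 3 t j ` insert (4 * m + 5) ({..<5} - {t, Suc t mod 5})
      = id ` insert (4 * m + 5) ({..<5} - {t, Suc t mod 5})"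
    using t j by (intro image_cong refl) (auto intro!: exchange_fixes simp: exchange_def)
  then show ?thesis
    using t unfolding star_def image_Un
    by (simp only: fst_map_prod_image snd_map_prod_image exchange_pair_image image_id) simp
qed

lemma exchange_ones:
  assumes t: "t < 5" and j: "j \<le> m"
  shows "exchange 3 t j ` ones m t X = ones m t (Transposition.transpose 0 j ` X)"
  unfolding ones_def image_Un snd_map_prod_image
  using t j by (simp add: exchange_pair_image exchange_pair_other_image transpose_image_atMost_Diff)

text \<open>The pair with index 0 belongs to both blocks. If it is swapped, it can be counted with
  the row's reserve pairs, which are all swapped too; then \<open>exchange 3 t j\<close> merely
  permutes that full block.\<close>

lemma swaps_out:
  assumes "0 \<notin> Y"
  shows "swaps m t Y = pair (2 * m + 3) t ` ({1..m} - Y) \<union> pair 3 t ` {..m}"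
proof -
  have "{..m} - Y = insert 0 ({1..m} - Y)" "{..m} = insert 0 {1..m}"
    using assms by auto
  moreover have "pair (2 * m + 3) t 0 = pair 3 t 0" by (simp add: pair_def)
  ultimately show ?thesis unfolding swaps_def by auto
qed

text \<open>The same regrouping on the row side: an unstarred core pair is labelled like the
  column's reserve pairs.\<close>

lemma ones_out:
  assumes "0 \<notin> X"
  shows "ones m t X = snd ` pair 3 t ` ({1..m} - X) \<union> snd ` pair (2 * m + 3) t ` {..m}"
proof -
  have "{..m} - X = insert 0 ({1..m} - X)" "{..m} = insert 0 {1..m}"
    using assms by auto
  moreover have "pair (2 * m + 3) t 0 = pair 3 t 0" by (simp add: pair_def)
  ultimately show ?thesis unfolding ones_def by auto
qed

lemma transpose_image_atMost: "j \<le> m \<Longrightarrow> Transposition.transpose 0 j ` {..m} = {..m}"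
  for m :: nat
  using permutes_image[OF permutes_swap_id[of 0 "{..m}" j]] by simp

lemma exchange_swaps_fixed:
  assumes t: "t < 5" and j: "j \<le> m" and "0 \<notin> Y"
  shows "map_prod (exchange 3 t j) (exchange 3 t j) ` swaps m t Y = swaps m t Y"
proof -
  have "{1..m} - Y \<subseteq> {1..m}" by blast
  then show ?thesis
    unfolding swaps_out[OF assms(3)] image_Un
    using t j by (simp add: exchange_pair_image exchange_pair_other_image transpose_image_atMost)
qed

lemma exchange_swaps:
  assumes t: "t < 5" and j: "j \<le> m"
  shows "map_prod (exchange (2 * m + 3) t j) (exchange (2 * m + 3) t j) ` swaps m t Y
    = swaps m t (Transposition.transpose 0 j ` Y)"
  unfolding swaps_def image_Un
  using t j by (simp add: exchange_pair_image exchange_pair_other_image transpose_image_atMost_Diff)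

lemma exchange_ones_fixed:
  assumes t: "t < 5" and j: "j \<le> m" and "0 \<notin> X"
  shows "exchange (2 * m + 3) t j ` ones m t X = ones m t X"
proof -
  have "{1..m} - X \<subseteq> {1..m}" by blast
  then show ?thesis
    unfolding ones_out[OF assms(3)] image_Un snd_map_prod_image
    using t j by (simp add: exchange_pair_image exchange_pair_other_image transpose_image_atMost)
qed

lemma exchange_star_fixed:
  assumes t: "t < 5" and j: "j \<le> m" and X: "X \<subseteq> {..m}" "0 \<notin> X"
  shows "exchange (2 * m + 3) t j ` star m t X = star m t X"
proof -
  have "X \<subseteq> {1..m}" using X by (auto simp: Suc_le_eq intro: gr0I)
  have "exchange (2 * m + 3) t j ` insert (4 * m + 5) ({..<5} - {t, Suc t mod 5})
      = id ` insert (4 * m + 5) ({..<5} - {t, Suc t mod 5})"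
    using t j by (intro image_cong refl) (auto intro!: exchange_fixes simp: exchange_def)
  then show ?thesis
    using exchange_pair_other_image(2)[OF t j \<open>X \<subseteq> {1..m}\<close>] unfolding star_def image_Un
    by (simp only: fst_map_prod_image snd_map_prod_image image_id) simp
qed

lemma exchange_top: "t < 5 \<Longrightarrow> j \<le> m \<Longrightarrow> s \<in> {3, 2 * m + 3} \<Longrightarrow> exchange s t j (4 * m + 5) = 4 * m + 5"
  by (cases "j = 0") (auto simp: exchange_def intro!: exchange_fixes)

text \<open>With the core pair starred the whole core is starred, and \<open>t\<close> becomes
  invisible. Therefore all five patterns are compared with one and the same weight.\<close>

lemma star_ones_in:
  assumes "0 \<in> X" "t < 5"
  shows "star m t X = star m 0 X" "ones m t X = ones m 0 X"
proof -
  show "ones m t X = ones m 0 X"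
    unfolding ones_def image_image using assms
    by (intro arg_cong2[of _ _ _ _ "(\<union>)"] image_cong refl) (auto simp: pair_def)
  have "i \<in> star m s X \<longleftrightarrow> i = 4 * m + 5 \<or> i < 5 \<or> (\<exists>k\<in>X. 0 < k \<and> (i = 3 + 2 * k \<or> i = 4 + 2 * k))"
    if "s < 5" for i s
    using Suc_mod_5[OF that] that assms(1) unfolding star_mem by blast
  then show "star m t X = star m 0 X" using assms(2) by (simp add: set_eq_iff)
qed

lemma swaps_in:
  assumes "0 \<in> Y"
  shows "swaps m t Y = swaps m 0 Y"
  unfolding swaps_def using assms
  by (intro arg_cong2[of _ _ _ _ "(\<union>)"] image_cong refl) (auto simp: pair_def)

section \<open>Admissibility of the rows and columns, and their mismatch counts\<close>

lemma star_ones_disjoint: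
  assumes t: "t < 5" and X: "X \<subseteq> {..m}"
  shows "star m t X \<inter> ones m t X = {}"
proof -
  have False if "i \<in> star m t X" "i \<in> ones m t X" for i
  proof -
    from that(2) consider "0 \<notin> X" "i = Suc t mod 5" | k where "k \<in> {1..m}" "k \<notin> X" "i = 4 + 2 * k"
      | k where "k \<in> {1..m}" "i = 2 * m + 4 + 2 * k"
      unfolding ones_mem[OF X] by blast
    then show False
    proof cases
      case 1
      then show False using that(1) star_iff(1)[OF t X, of i] by simp
    next
      case (2 k)
      then show False using that(1) star_iff(3)[OF t X, of k] by simp
    next
      case (3 k)
      then have "i = 4 * m + 5" using that(1) star_iff(4)[OF t X, of i] by simp
      then show False using 3 by presburger
    qed
  qed
  then show ?thesis by blast
qed

lemma star_subset:
  assumes t: "t < 5" and X: "X \<subseteq> {..m}" and n: "4 * m + 6 \<le> n"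
  shows "star m t X \<subseteq> {..<n}"
proof
  fix i assume "i \<in> star m t X"
  then consider "i = 4 * m + 5" | "i < 5" | "i = t" | "i = Suc t mod 5"
    | k where "k \<in> X" "i \<le> 4 + 2 * k"
    unfolding star_mem by force
  then show "i \<in> {..<n}"
  proof cases
    case (5 k)
    then have "k \<le> m" using X by blast
    then show ?thesis using 5 n by simp
  qed (use t n Suc_mod_5[OF t] in auto)
qed

lemma ones_subset:
  assumes t: "t < 5" and X: "X \<subseteq> {..m}" and n: "4 * m + 6 \<le> n"
  shows "ones m t X \<subseteq> {..<n}"
proof
  fix i assume "i \<in> ones m t X"
  then consider "i = Suc t mod 5" | k where "k \<le> m" "i \<le> 2 * m + 4 + 2 * k"
    unfolding ones_mem[OF X] by force
  then show "i \<in> {..<n}"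
    by cases (use t n Suc_mod_5[OF t] in auto)
qed

text \<open>The loop vertex \<open>4 * m + 5\<close> and three core vertices make four, and every
  index in \<open>X\<close> adds two more.\<close>

lemma even_card_star:
  assumes t: "t < 5" and X: "X \<subseteq> {..m}"
  shows "even (card (star m t X))"
proof -
  define t' where "t' = Suc t mod 5"
  have t': "t' < 5" "t' \<noteq> t" using Suc_mod_5[OF t] by (simp_all add: t'_def)
  have fX: "finite X" using X finite_subset by blast
  let ?K = "insert (4 * m + 5) ({..<5} - {t, t'})"
  let ?A = "(\<lambda>j. fst (pair 3 t j)) ` X" and ?B = "(\<lambda>j. snd (pair 3 t j)) ` X"
  have star: "star m t X = ?K \<union> ?A \<union> ?B"
    by (simp add: star_def image_image t'_def)
  have cA: "card ?A = card X" and cB: "card ?B = card X"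
    using t t' by (intro card_image inj_onI; auto simp: pair_eqs t'_def[symmetric] split: if_splits)+
  have AB: "?A \<inter> ?B = {}" and K: "?K \<inter> (?A \<union> ?B) = {}"
    using t t' X by (auto simp: pair_eqs t'_def[symmetric] split: if_splits; presburger)+
  have "card ?K = 4" using t t' by (simp add: card_Diff_subset)
  moreover have "card (?K \<union> (?A \<union> ?B)) = card ?K + (card ?A + card ?B)"
    using fX AB K by (simp add: card_Un_disjoint)
  ultimately have "card (star m t X) = 4 + (card X + card X)"
    unfolding star Un_assoc cA cB by simp
  then show ?thesis by simp
qed

lemma Field_swaps:
  "i \<in> Field (swaps m t Y) \<longleftrightarrow> 0 \<notin> Y \<and> (i = t \<or> i = Suc t mod 5) \<or>
     (\<exists>k\<in>{1..m}. k \<notin> Y \<and> (i = 2 * m + 3 + 2 * k \<or> i = 2 * m + 4 + 2 * k)) \<or>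
     (\<exists>k\<in>{1..m}. i = 3 + 2 * k \<or> i = 4 + 2 * k)"
proof -
  have Field: "Field R = fst ` R \<union> snd ` R" for R :: "(nat \<times> nat) set"
    by (force simp: Field_def)
  have "i \<in> Field (swaps m t Y) \<longleftrightarrow>
      (\<exists>k\<in>{..m} - Y. i = fst (pair (2 * m + 3) t k) \<or> i = snd (pair (2 * m + 3) t k)) \<or>
      (\<exists>k\<in>{1..m}. i = fst (pair 3 t k) \<or> i = snd (pair 3 t k))"
    unfolding Field swaps_def image_Un image_image Un_iff image_iff by blast
  also have "{..m} - Y = (if 0 \<in> Y then {} else {0}) \<union> ({1..m} - Y)"
    by (auto simp: Suc_le_eq intro: gr0I)
  finally show ?thesis by (auto simp: pair_eqs)
qed

text \<open>Starred vertices outside the core, other than the loop vertex, lie in the row's reserve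
  pairs, which every column swaps. What remains is decided in the core.\<close>

lemma star_minus_swaps:
  assumes t: "t < 5" "t' < 5" and X: "X \<subseteq> {..m}"
  shows "star m t X - Field (swaps m t' Y) - {4 * m + 5} =
    {..<5} - (if 0 \<in> X then {} else {t, Suc t mod 5}) - (if 0 \<in> Y then {} else {t', Suc t' mod 5})"
  (is "?L = ?R")
proof (rule set_eqI)
  fix i
  show "i \<in> ?L \<longleftrightarrow> i \<in> ?R"
  proof (cases "i < 5")
    case True
    have "i \<in> Field (swaps m t' Y) \<longleftrightarrow> 0 \<notin> Y \<and> (i = t' \<or> i = Suc t' mod 5)"
      unfolding Field_swaps using True by auto
    then show ?thesis using True star_iff(1)[OF t(1) X True] by auto
  next
    case False
    have "i \<in> Field (swaps m t' Y)" if i: "i \<in> star m t X" "i \<noteq> 4 * m + 5"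
    proof -
      have "i \<noteq> t" "i \<noteq> Suc t mod 5" using False t Suc_mod_5[OF t(1)] by auto
      then obtain k where k: "k \<in> X" "0 < k" "i = 3 + 2 * k \<or> i = 4 + 2 * k"
        using i False unfolding star_mem by blast
      then have "k \<in> {1..m}" using X by auto
      then show ?thesis unfolding Field_swaps using k(3) by blast
    qed
    then show ?thesis using False by auto
  qed
qed

text \<open>The hypothesis \<open>comp\<close> excludes that row and column resolve distinct
  overlapping core pairs: a red swap would then join a starred vertex to an unstarred one.\<close>

lemma card_mismatched_frame:
  assumes t: "t < 5" "t' < 5" and X: "X \<subseteq> {..m}"
    and n: "4 * m + 6 \<le> n" and p: "p permutes {..<n}"
    and comp: "0 \<in> X \<or> 0 \<in> Y \<or> t = t' \<or> {t, Suc t mod 5} \<inter> {t', Suc t' mod 5} = {}"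
  shows "card {e \<in> matching n (p (4 * m + 5)) (map_prod p p ` swaps m t' Y).
      mismatched (p ` star m t X, p ` ones m t X) e} =
    card ({..<5} - (if 0 \<in> X then {} else {t, Suc t mod 5}) -
      (if 0 \<in> Y then {} else {t', Suc t' mod 5}))"
proof -
  let ?S = "star m t X" and ?T = "ones m t X" and ?J = "swaps m t' Y" and ?z = "4 * m + 5"
  have inj: "inj p" using permutes_inj[OF p] .
  have "{e \<in> matching n (p ?z) (map_prod p p ` ?J). mismatched (p ` ?S, p ` ?T) e}
      = (\<lambda>i. (i, i, Blue)) ` (p ` ?S - Field (map_prod p p ` ?J) - {p ?z})"
  proof (rule mismatched_matching)
    show "p ` ?S \<inter> p ` ?T = {}"
      using star_ones_disjoint[OF t(1) X] image_Int[OF inj, of ?S ?T] by simp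
    show "p ?z \<in> p ` ?S" by (simp add: star_mem)
    have "p ` ?S \<subseteq> p ` {..<n}" by (intro image_mono star_subset t X n)
    then show "p ` ?S \<subseteq> {..<n}" using permutes_image[OF p] by simp
  next
    fix a b assume "(a, b) \<in> map_prod p p ` ?J"
    then obtain i j where ij: "(i, j) \<in> ?J" "a = p i" "b = p j" by auto
    have m': "Suc t' mod 5 < 5" "Suc t' mod 5 \<noteq> t'" using Suc_mod_5[OF t(2)] by simp_all
    have "i \<in> ?S \<and> j \<in> ?S \<or> i \<notin> ?S \<and> j \<notin> ?S \<and> (i \<in> ?T) \<noteq> (j \<in> ?T)"
      using ij(1)
    proof (rule swaps_cases)
      assume "0 \<notin> Y" "i = t'" "j = Suc t' mod 5"
      then show ?thesis
        using star_iff(1)[OF t(1) X, of i] star_iff(1)[OF t(1) X, of j]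
          ones_iff(1)[OF t(1) X, of i] ones_iff(1)[OF t(1) X, of j] comp m' t
        by auto
    next
      fix k assume k: "k \<in> {1..m}" "i = 2 * m + 3 + 2 * k" "j = 2 * m + 4 + 2 * k"
      have "i \<noteq> 4 * m + 5" "j \<noteq> 4 * m + 5" "2 * m + 5 \<le> i" "2 * m + 5 \<le> j" using k by auto
      then show ?thesis
        using star_iff(4)[OF t(1) X, of i] star_iff(4)[OF t(1) X, of j]
          ones_iff(4,5)[OF t(1) X k(1)] k(2,3) by simp
    next
      fix k assume "k \<in> {1..m}" "i = 3 + 2 * k" "j = 4 + 2 * k"
      then show ?thesis
        using star_iff(2,3)[OF t(1) X, of k] ones_iff(2,3)[OF t(1) X, of k] by auto
    qed
    then show "a \<in> p ` ?S \<and> b \<in> p ` ?S \<or>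
        a \<notin> p ` ?S \<and> b \<notin> p ` ?S \<and> (a \<in> p ` ?T) \<noteq> (b \<in> p ` ?T)"
      unfolding ij(2,3) inj_image_mem_iff[OF inj] .
  qed
  also have "p ` ?S - Field (map_prod p p ` ?J) - {p ?z} = p ` (?S - Field ?J - {?z})"
  proof -
    have "Field (map_prod p p ` ?J) = p ` Field ?J" by (force simp: Field_def)
    then show ?thesis using image_set_diff[OF inj, of ?S "Field ?J"]
        image_set_diff[OF inj, of "?S - Field ?J" "{?z}"] by simp
  qed
  finally have "card {e \<in> matching n (p ?z) (map_prod p p ` ?J). mismatched (p ` ?S, p ` ?T) e}
      = card ((\<lambda>i. (i, i, Blue)) ` p ` (?S - Field ?J - {?z}))" by simp
  also have "\<dots> = card (p ` (?S - Field ?J - {?z}))"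
    by (intro card_image) (auto simp: inj_on_def)
  also have "\<dots> = card (?S - Field ?J - {?z})"
    using inj by (intro card_image) (auto simp: inj_on_def)
  finally show ?thesis unfolding star_minus_swaps[OF t X] .
qed

definition rows :: "nat \<Rightarrow> (nat set \<times> nat set) set" where
  "rows n = {(S, T). S \<subseteq> {..<n} \<and> T \<subseteq> {..<n} \<and> S \<inter> T = {} \<and> even (card S)}"

definition row :: "nat \<Rightarrow> nat \<Rightarrow> (nat \<Rightarrow> nat) \<Rightarrow> nat set \<Rightarrow> nat set \<times> nat set" where
  "row m t p X = (p ` star m t X, p ` ones m t X)"

definition column :: "nat \<Rightarrow> nat \<Rightarrow> nat \<Rightarrow> (nat \<Rightarrow> nat) \<Rightarrow> nat set \<Rightarrow> edge set" where
  "column n m t p Y = matching n (p (4 * m + 5)) (map_prod p p ` swaps m t Y)"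

lemma row_in_rows:
  assumes t: "t < 5" and X: "X \<subseteq> {..m}" and n: "4 * m + 6 \<le> n" and p: "p permutes {..<n}"
  shows "row m t p X \<in> rows n"
proof -
  have inj: "inj p" using permutes_inj[OF p] .
  have "p ` A \<subseteq> {..<n}" if "A \<subseteq> {..<n}" for A
    using image_mono[OF that, of p] permutes_image[OF p] by simp
  moreover have "p ` star m t X \<inter> p ` ones m t X = {}"
    using star_ones_disjoint[OF t X] image_Int[OF inj, of "star m t X" "ones m t X"] by simp
  moreover have "card (p ` star m t X) = card (star m t X)"
    using inj by (intro card_image) (auto simp: inj_on_def)
  ultimately show ?thesis
    using star_subset[OF t X n] ones_subset[OF t X n] even_card_star[OF t X]
    by (simp add: rows_def row_def)
qed

lemma column_in_matchings:
  assumes "t < 5" "4 * m + 6 \<le> n" "p permutes {..<n}"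
  shows "column n m t p Y \<in> odd_perfect_matchings n"
  unfolding column_def using assms by (intro matching_odd pairing_permute pairing_swaps)

text \<open>The five core vertices, less one pair resolved by both sides, or less two pairs: those
  of \<open>t\<close> and \<open>(t + 2) mod 5\<close> are disjoint on the 5-cycle.\<close>

lemma mismatched_row_column:
  assumes t: "t < 5" and X: "X \<subseteq> {..m}"
    and n: "4 * m + 6 \<le> n" and p: "p permutes {..<n}"
  shows "0 \<in> X \<Longrightarrow> 0 \<in> Y \<Longrightarrow> card {e \<in> column n m t p Y. mismatched (row m t p X) e} = 5"
    and "0 \<notin> X \<Longrightarrow> 0 \<notin> Y \<Longrightarrow> card {e \<in> column n m t p Y. mismatched (row m t p X) e} = 3"
    and "0 \<notin> X \<Longrightarrow> 0 \<notin> Y \<Longrightarrow>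
      card {e \<in> column n m ((t + 2) mod 5) p Y. mismatched (row m t p X) e} = 1"
proof -
  note frame = card_mismatched_frame[OF t _ X n p, folded column_def row_def]
  show "card {e \<in> column n m t p Y. mismatched (row m t p X) e} = 5" if "0 \<in> X" "0 \<in> Y"
    using frame[OF t, of Y] that by simp
  show "card {e \<in> column n m t p Y. mismatched (row m t p X) e} = 3" if "0 \<notin> X" "0 \<notin> Y"
    using frame[OF t, of Y] that t Suc_mod_5[OF t] by (simp add: card_Diff_subset)
  have c: "t \<in> {0, 1, 2, 3, 4}" using t by auto
  show "card {e \<in> column n m ((t + 2) mod 5) p Y. mismatched (row m t p X) e} = 1"
    if "0 \<notin> X" "0 \<notin> Y"
    using c frame[of "(t + 2) mod 5" Y] that by (auto simp: card_Diff_subset)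
qed

lemma row_exchange:
  assumes "t < 5" "j \<le> m"
  shows "row m t (p \<circ> exchange 3 t j) X = row m t p (Transposition.transpose 0 j ` X)"
  unfolding row_def image_comp[symmetric] by (simp only: exchange_star[OF assms] exchange_ones[OF assms])

lemma row_exchange_fixed:
  assumes "t < 5" "j \<le> m" "X \<subseteq> {..m}" "0 \<notin> X"
  shows "row m t (p \<circ> exchange (2 * m + 3) t j) X = row m t p X"
  unfolding row_def image_comp[symmetric]
  by (simp only: exchange_star_fixed[OF assms] exchange_ones_fixed[OF assms(1,2,4)])

lemma map_prod_comp_image: "map_prod (f \<circ> g) (f \<circ> g) ` A = map_prod f f ` map_prod g g ` A"
  unfolding image_image by (intro image_cong) auto

lemma column_exchange:
  assumes "t < 5" "j \<le> m"
  shows "column n m t (p \<circ> exchange (2 * m + 3) t j) Y = column n m t p (Transposition.transpose 0 j ` Y)"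
  unfolding column_def map_prod_comp_image exchange_swaps[OF assms]
  using exchange_top[OF assms, of "2 * m + 3"] by simp

lemma column_exchange_fixed:
  assumes "t < 5" "j \<le> m" "0 \<notin> Y"
  shows "column n m t (p \<circ> exchange 3 t j) Y = column n m t p Y"
  unfolding column_def map_prod_comp_image exchange_swaps_fixed[OF assms]
  using exchange_top[OF assms(1,2), of 3] by simp

lemma row_in: "0 \<in> X \<Longrightarrow> t < 5 \<Longrightarrow> row m t p X = row m 0 p X"
  by (simp add: row_def star_ones_in[of X t])

lemma column_in: "0 \<in> Y \<Longrightarrow> column n m t p Y = column n m 0 p Y"
  unfolding column_def using swaps_in[of Y m t] by simp

section \<open>Nonnegative factorizations of the slack matrix\<close>

lemma not_unbalanced_le:
  "\<not> unbalanced m F j \<Longrightarrow> sum_out m F j \<le> 101 / 99 * sum_in m F j"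
  unfolding unbalanced_def abs_le_iff not_less by argo

text \<open>Steps of length 2 on a 5-cycle form another 5-cycle, whose independent sets have at most
  2 elements.\<close>

lemma card_independent_5_cycle:
  fixes N :: "nat set"
  assumes N: "N \<subseteq> {..<5}" and ind: "\<And>t. t \<in> N \<Longrightarrow> (t + 2) mod 5 \<notin> N"
  shows "card N \<le> 2"
proof -
  have five: "{..<5} = {0, 1, 2, 3, 4 :: nat}" by auto
  have "card N = (\<Sum>t<5. if t \<in> N then 1 else 0)"
    using N by (simp add: sum.If_cases Int_absorb1)
  also have "\<dots> = of_bool (0 \<in> N) + of_bool (1 \<in> N) + of_bool (2 \<in> N) + of_bool (3 \<in> N) + of_bool (4 \<in> N)"
    unfolding five by (simp add: of_bool_def)
  also have "\<dots> \<le> 2"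
  proof -
    have "0 \<in> N \<longrightarrow> 2 \<notin> N" "1 \<in> N \<longrightarrow> 3 \<notin> N" "2 \<in> N \<longrightarrow> 4 \<notin> N" "3 \<in> N \<longrightarrow> 0 \<notin> N" "4 \<in> N \<longrightarrow> 1 \<notin> N"
      using ind[of 0] ind[of 1] ind[of 2] ind[of 3] ind[of 4] by (simp_all add: numeral_2_eq_2)
    then show ?thesis
      by (cases "0 \<in> N"; cases "1 \<in> N"; cases "2 \<in> N"; cases "3 \<in> N"; cases "4 \<in> N"; simp)
  qed
  finally show ?thesis .
qed

lemma card_subsets_out: "card {X. X \<subseteq> {..m} \<and> (0::nat) \<notin> X} = 2 ^ m"
proof -
  have "{X. X \<subseteq> {..m} \<and> 0 \<notin> X} = Pow ({..m} - {0})" by auto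
  then show ?thesis by (simp add: card_Pow)
qed

lemma card_subsets_in: "card {X. X \<subseteq> {..m} \<and> (0::nat) \<in> X} = 2 ^ m"
proof -
  have "bij_betw (insert 0) {X. X \<subseteq> {..m} \<and> (0::nat) \<notin> X} {X. X \<subseteq> {..m} \<and> 0 \<in> X}"
    by (rule bij_betw_byWitness[of _ "\<lambda>X. X - {0}"]) auto
  then show ?thesis using bij_betw_same_card card_subsets_out by metis
qed

lemma sum_out_le:
  assumes "\<And>X. X \<subseteq> {..m} \<Longrightarrow> F X \<le> a"
  shows "sum_out m F 0 \<le> 2 ^ m * a"
  using sum_bounded_above[of "{X. X \<subseteq> {..m} \<and> 0 \<notin> X}" F a] assms
  by (simp add: sum_out_def card_subsets_out)

text \<open>A pattern \<open>t\<close> contributes only if the row and the column it calls for both occur. Two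
  patterns at distance 2 on the 5-cycle combine to a row and a column with a single mismatch, so
  at most 2 of the 5 patterns contribute.\<close>

lemma rectangle_bound:
  fixes f :: "nat set \<times> nat set \<Rightarrow> real" and g :: "edge set \<Rightarrow> real"
  assumes n: "4 * m + 6 \<le> n"
    and f: "\<And>r. r \<in> rows n \<Longrightarrow> 0 \<le> f r" "\<And>r. r \<in> rows n \<Longrightarrow> f r \<le> a"
    and g: "\<And>M. M \<in> odd_perfect_matchings n \<Longrightarrow> 0 \<le> g M"
      "\<And>M. M \<in> odd_perfect_matchings n \<Longrightarrow> g M \<le> b"
    and zero: "\<And>r M. r \<in> rows n \<Longrightarrow> M \<in> odd_perfect_matchings n \<Longrightarrow>
      card {e \<in> M. mismatched r e} = 1 \<Longrightarrow> f r * g M = 0"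
  shows "94 / 100 * (\<Sum>p | p permutes {..<n}. \<Sum>t<5.
        sum_out m (\<lambda>X. f (row m t p X)) 0 * sum_out m (\<lambda>Y. g (column n m t p Y)) 0)
    \<le> 2 * (101 / 99)\<^sup>2 * (\<Sum>p | p permutes {..<n}.
        sum_in m (\<lambda>X. f (row m 0 p X)) 0 * sum_in m (\<lambda>Y. g (column n m 0 p Y)) 0)
      + 10 * fact n * 2 ^ m * bias_error m * (a * b)"
proof -
  let ?P = "{p. p permutes {..<n}}"
  define F where "F t p X = f (row m t p X)" for t p X
  define G where "G t p Y = g (column n m t p Y)" for t p Y
  define A where "A t p = sum_out m (F t p) 0" for t p
  define B where "B t p = sum_out m (G t p) 0" for t p
  define A1 where "A1 p = sum_in m (F 0 p) 0" for p
  define B1 where "B1 p = sum_in m (G 0 p) 0" for p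
  \<comment> \<open>The contributions with an unbalanced row or column weight; they can be
    controlled only after averaging over \<open>p\<close>.\<close>
  define uF where "uF t p = (if unbalanced m (F t p) 0 then B t p * A t p else 0)" for t p
  define uG where "uG t p = (if unbalanced m (G t p) 0 then A t p * B t p else 0)" for t p
  have F: "0 \<le> F t p X" "F t p X \<le> a" if "t < 5" "p \<in> ?P" "X \<subseteq> {..m}" for t p X
    using that row_in_rows[of t X m n p] f n by (auto simp: F_def)
  have G: "0 \<le> G t p X" "G t p X \<le> b" if "t < 5" "p \<in> ?P" for t p X
    using that column_in_matchings[of t m n p X] g n by (auto simp: G_def)
  have A0: "0 \<le> A t p" if "t < 5" "p \<in> ?P" for t p
    unfolding A_def sum_out_def using F(1)[OF that] by (intro sum_nonneg) auto
  have B0: "0 \<le> B t p" if "t < 5" "p \<in> ?P" for t p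
    unfolding B_def sum_out_def using G(1)[OF that] by (intro sum_nonneg) auto
  \<comment> \<open>The weights with unresolved core do not depend on the pattern, so
    \<open>A1 p * B1 p\<close> serves all \<open>t\<close> at once.\<close>
  have A1: "sum_in m (F t p) 0 = A1 p" if "t < 5" for t p
    unfolding A1_def sum_in_def F_def using that by (intro sum.cong) (auto simp: row_in[of _ t])
  have B1: "sum_in m (G t p) 0 = B1 p" for t p
    unfolding B1_def sum_in_def G_def by (intro sum.cong) (auto simp: column_in[of _ n m t])
  have A10: "0 \<le> A1 p" if "p \<in> ?P" for p
    unfolding A1_def sum_in_def using F(1)[OF _ that, of 0] by (intro sum_nonneg) auto
  have B10: "0 \<le> B1 p" if "p \<in> ?P" for p
    unfolding B1_def sum_in_def using G(1)[OF _ that, of 0] by (intro sum_nonneg) auto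
  have fin: "finite ?P" by (simp add: finite_permutations)
  have cardP: "card ?P = fact n" by (simp add: card_permutations)
  have ab: "0 \<le> a" "0 \<le> b"
    using F[of 0 id "{}"] G[of 0 id "{}"] permutes_id[of "{..<n}"] by auto

  have pointwise: "(\<Sum>t<5. A t p * B t p) \<le> 2 * (101 / 99)\<^sup>2 * (A1 p * B1 p) + (\<Sum>t<5. uF t p + uG t p)"
    if p: "p \<in> ?P" for p
  proof -
    define N where "N = {t\<in>{..<5}. A t p * B t p \<noteq> 0}"
    have "card N \<le> 2"
    proof (rule card_independent_5_cycle)
      fix t assume t: "t \<in> N"
      show "(t + 2) mod 5 \<notin> N"
      proof
        assume t2: "(t + 2) mod 5 \<in> N"
        have "A t p \<noteq> 0" "B ((t + 2) mod 5) p \<noteq> 0" "t < 5"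
          using t t2 by (auto simp: N_def)
        then obtain X Y where X: "X \<subseteq> {..m}" "0 \<notin> X" "F t p X \<noteq> 0"
            and Y: "0 \<notin> Y" "G ((t + 2) mod 5) p Y \<noteq> 0"
          unfolding A_def B_def sum_out_def by (metis (mono_tags, lifting) mem_Collect_eq sum.neutral)
        have "f (row m t p X) * g (column n m ((t + 2) mod 5) p Y) = 0"
          using p X Y \<open>t < 5\<close> n
          by (intro zero row_in_rows column_in_matchings mismatched_row_column(3)) auto
        then show False using X Y by (simp add: F_def G_def)
      qed
    qed (auto simp: N_def)
    have "A t p * B t p \<le> (if t \<in> N then (101 / 99)\<^sup>2 * (A1 p * B1 p) else 0) + (uF t p + uG t p)"
      if t: "t \<in> {..<5}" for t
    proof -
      have t5: "t < 5" using t by simp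
      have AB: "0 \<le> A t p" "0 \<le> B t p" using A0[OF t5 p] B0[OF t5 p] .
      have A1B1: "0 \<le> (101 / 99)\<^sup>2 * (A1 p * B1 p)" using A10[OF p] B10[OF p] by simp
      have u: "0 \<le> uF t p" "0 \<le> uG t p" using AB by (simp_all add: uF_def uG_def)
      consider "t \<notin> N" | "unbalanced m (F t p) 0" | "unbalanced m (G t p) 0"
        | "t \<in> N" "\<not> unbalanced m (F t p) 0" "\<not> unbalanced m (G t p) 0" by blast
      then show ?thesis
      proof cases
        case 1
        then have "A t p * B t p = 0" using t by (simp add: N_def)
        then show ?thesis unfolding \<open>A t p * B t p = 0\<close> using 1 u by simp
      next
        case 2
        then have "uF t p = A t p * B t p" by (simp add: uF_def)
        then show ?thesis using u A1B1 by simp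
      next
        case 3
        then have "uG t p = A t p * B t p" by (simp add: uG_def)
        then show ?thesis using u A1B1 by simp
      next
        case 4
        have "A t p \<le> 101 / 99 * A1 p" "B t p \<le> 101 / 99 * B1 p"
          using not_unbalanced_le[OF 4(2)] not_unbalanced_le[OF 4(3)] A1[OF t5] B1
          by (simp_all add: A_def B_def)
        then have "A t p * B t p \<le> (101 / 99 * A1 p) * (101 / 99 * B1 p)"
          using AB A10[OF p] by (intro mult_mono) auto
        then show ?thesis using 4(1) u by (simp add: power2_eq_square)
      qed
    qed
    then have "(\<Sum>t<5. A t p * B t p) \<le>
        (\<Sum>t<5. (if t \<in> N then (101 / 99)\<^sup>2 * (A1 p * B1 p) else 0) + (uF t p + uG t p))"
      by (rule sum_mono)
    also have "\<dots> = (\<Sum>t<5. if t \<in> N then (101 / 99)\<^sup>2 * (A1 p * B1 p) else 0)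
        + (\<Sum>t<5. uF t p + uG t p)" by (rule sum.distrib)
    also have "(\<Sum>t<5. if t \<in> N then (101 / 99)\<^sup>2 * (A1 p * B1 p) else 0)
        = real (card N) * ((101 / 99)\<^sup>2 * (A1 p * B1 p))"
    proof -
      have "{..<5} \<inter> {t. t \<in> N} = N" by (auto simp: N_def)
      then show ?thesis by (simp add: sum.If_cases)
    qed
    also have "\<dots> \<le> 2 * ((101 / 99)\<^sup>2 * (A1 p * B1 p))"
      using \<open>card N \<le> 2\<close> A10[OF p] B10[OF p] by (intro mult_right_mono) auto
    finally show ?thesis by simp
  qed

  have e0: "0 \<le> bias_error m" by (simp add: bias_error_def)
  have uF: "(\<Sum>p\<in>?P. uF t p) \<le> 3 / 100 * (\<Sum>p\<in>?P. A t p * B t p) + fact n * 2 ^ m * bias_error m * (a * b)"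
    if t: "t < 5" for t
  proof -
    \<comment> \<open>The invariant factor is the column weight \<open>B t\<close>: it involves only
      columns whose core pair is swapped, and \<open>exchange 3 t j\<close> fixes these.\<close>
    have "(\<Sum>p\<in>?P. uF t p) \<le> 3 / 100 * (\<Sum>p\<in>?P. B t p * A t p) + a * bias_error m * (\<Sum>p\<in>?P. B t p)"
      unfolding uF_def A_def
    proof (rule unbalanced_average_le[where \<theta> = "exchange 3 t"])
      fix p j assume "p permutes {..<n}" "j \<le> m"
      then show "B t (p \<circ> exchange 3 t j) = B t p"
        unfolding B_def sum_out_def G_def
        by (intro sum.cong refl arg_cong[of _ _ g] column_exchange_fixed[OF t]) auto
    qed (use F[OF t] B0[OF t] t n in \<open>auto simp: row_exchange F_def intro!: exchange_permutes\<close>)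
    also have "(\<Sum>p\<in>?P. B t p) \<le> fact n * (2 ^ m * b)"
      using sum_bounded_above[of ?P "B t" "2 ^ m * b"] sum_out_le[of m "G t _" b] G(2)[OF t]
      by (simp add: cardP B_def)
    then have "a * bias_error m * (\<Sum>p\<in>?P. B t p) \<le> a * bias_error m * (fact n * (2 ^ m * b))"
      using ab e0 by (intro mult_left_mono) auto
    finally show ?thesis by (simp add: mult_ac)
  qed
  have uG: "(\<Sum>p\<in>?P. uG t p) \<le> 3 / 100 * (\<Sum>p\<in>?P. A t p * B t p) + fact n * 2 ^ m * bias_error m * (a * b)"
    if t: "t < 5" for t
  proof -
    have "(\<Sum>p\<in>?P. uG t p) \<le> 3 / 100 * (\<Sum>p\<in>?P. A t p * B t p) + b * bias_error m * (\<Sum>p\<in>?P. A t p)"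
      unfolding uG_def B_def
    proof (rule unbalanced_average_le[where \<theta> = "exchange (2 * m + 3) t"])
      fix p j assume "p permutes {..<n}" "j \<le> m"
      then show "A t (p \<circ> exchange (2 * m + 3) t j) = A t p"
        unfolding A_def sum_out_def F_def
        by (intro sum.cong refl arg_cong[of _ _ f] row_exchange_fixed[OF t]) auto
    qed (use G[OF t] A0[OF t] t n in \<open>auto simp: column_exchange G_def intro!: exchange_permutes\<close>)
    also have "(\<Sum>p\<in>?P. A t p) \<le> fact n * (2 ^ m * a)"
      using sum_bounded_above[of ?P "A t" "2 ^ m * a"] sum_out_le[of m "F t _" a] F(2)[OF t]
      by (simp add: cardP A_def)
    then have "b * bias_error m * (\<Sum>p\<in>?P. A t p) \<le> b * bias_error m * (fact n * (2 ^ m * a))"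
      using ab e0 by (intro mult_left_mono) auto
    finally show ?thesis by (simp add: mult_ac)
  qed
  define Z where "Z = (\<Sum>p\<in>?P. \<Sum>t<5. A t p * B t p)"
  define E where "E = fact n * 2 ^ m * bias_error m * (a * b)"
  have "Z \<le> (\<Sum>p\<in>?P. 2 * (101 / 99)\<^sup>2 * (A1 p * B1 p) + (\<Sum>t<5. uF t p + uG t p))"
    unfolding Z_def by (intro sum_mono pointwise)
  also have "\<dots> = 2 * (101 / 99)\<^sup>2 * (\<Sum>p\<in>?P. A1 p * B1 p) + (\<Sum>t<5. \<Sum>p\<in>?P. uF t p + uG t p)"
    by (simp add: sum.distrib sum_distrib_left sum.swap[of _ ?P])
  also have "(\<Sum>t<5. \<Sum>p\<in>?P. uF t p + uG t p) \<le> (\<Sum>t<5. 6 / 100 * (\<Sum>p\<in>?P. A t p * B t p) + 2 * E)"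
  proof (rule sum_mono)
    fix t :: nat assume "t \<in> {..<5}"
    then have "t < 5" by simp
    then show "(\<Sum>p\<in>?P. uF t p + uG t p) \<le> 6 / 100 * (\<Sum>p\<in>?P. A t p * B t p) + 2 * E"
      using uF[of t] uG[of t] unfolding sum.distrib E_def by linarith
  qed
  also have "\<dots> = 6 / 100 * Z + 10 * E"
    unfolding Z_def sum.distrib sum_distrib_left[symmetric] by (subst sum.swap) simp
  finally have "94 / 100 * Z \<le> 2 * (101 / 99)\<^sup>2 * (\<Sum>p\<in>?P. A1 p * B1 p) + 10 * E" by simp
  then show ?thesis
    by (simp add: Z_def E_def A_def B_def A1_def B1_def F_def[abs_def] G_def[abs_def] mult.assoc)
qed

lemma column_exists: "4 * m + 6 \<le> n \<Longrightarrow> odd_perfect_matchings n \<noteq> {}"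
  using column_in_matchings[of 0 m n id "{}"] permutes_id[of "{..<n}"] by auto

lemma finite_rows: "finite (rows n)"
  by (rule finite_subset[of _ "Pow {..<n} \<times> Pow {..<n}"]) (auto simp: rows_def)

lemma rows_nonempty: "({}, {}) \<in> rows n"
  by (simp add: rows_def)

lemma card_matching: "M \<in> odd_perfect_matchings n \<Longrightarrow> card M = n"
  using perfect_matching_bij(1)[of n M] bij_betw_same_card by (fastforce simp: odd_perfect_matchings_def)

lemma finite_matching: "M \<in> odd_perfect_matchings n \<Longrightarrow> finite M"
  by (rule finite_subset[of _ "edges n"]) (auto simp: odd_perfect_matchings_def perfect_matching_def edges_def)

text \<open>Summed over \<open>i\<close>, the products in \<open>rectangle_bound\<close> become
  slacks: 2 for each of the five patterns on the left, 4 on the right. The main terms violate the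
  inequality, so the \<open>card I\<close> error terms must make up for the difference.\<close>

lemma factorization_size:
  fixes f :: "'i \<Rightarrow> nat set \<times> nat set \<Rightarrow> real" and g :: "'i \<Rightarrow> edge set \<Rightarrow> real"
  assumes n: "4 * m + 6 \<le> n" and I: "finite I"
    and f: "\<And>i r. 0 \<le> f i r" and g: "\<And>i M. M \<in> odd_perfect_matchings n \<Longrightarrow> 0 \<le> g i M"
    and slack: "\<And>r M. r \<in> rows n \<Longrightarrow> M \<in> odd_perfect_matchings n \<Longrightarrow>
      real (card {e \<in> M. mismatched r e}) - 1 = (\<Sum>i\<in>I. f i r * g i M)"
  shows "1 \<le> 20 * real n * real (card I) * exp (- real (m + 1) / 4000000)"
proof -
  let ?P = "{p. p permutes {..<n}}" and ?Ms = "odd_perfect_matchings n"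
  define a where "a i = Max (f i ` rows n)" for i
  define b where "b i = Max (g i ` ?Ms)" for i
  have Ms: "finite ?Ms" "?Ms \<noteq> {}" using finite_odd_perfect_matchings column_exists[OF n] by auto
  have fa: "f i r \<le> a i" if "r \<in> rows n" for i r
    unfolding a_def using finite_rows that by (intro Max_ge) auto
  have gb: "g i M \<le> b i" if "M \<in> ?Ms" for i M
    unfolding b_def using Ms that by (intro Max_ge) auto
  have fg_le: "f i r * g i M \<le> real (card {e \<in> M. mismatched r e}) - 1"
    if "i \<in> I" "r \<in> rows n" "M \<in> ?Ms" for i r M
    unfolding slack[OF that(2,3)] using f g[OF that(3)] that(1) I
    by (intro member_le_sum[of i I "\<lambda>i. f i r * g i M"]) auto
  \<comment> \<open>Both maxima are attained, and independently of each other, so their product is a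
    single term in some slack entry. This bounds the error whatever the scaling of
    \<open>f i\<close> and \<open>g i\<close>.\<close>
  have ab: "a i * b i \<le> real n" if i: "i \<in> I" for i
  proof -
    have "a i \<in> f i ` rows n" unfolding a_def using finite_rows rows_nonempty by (intro Max_in) auto
    moreover have "b i \<in> g i ` ?Ms" unfolding b_def using Ms by (intro Max_in) auto
    ultimately obtain r M where rM: "r \<in> rows n" "M \<in> ?Ms" "a i = f i r" "b i = g i M" by blast
    have "card {e \<in> M. mismatched r e} \<le> n"
      using card_mono[of M "{e \<in> M. mismatched r e}"] finite_matching[OF rM(2)] card_matching[OF rM(2)]
      by auto
    then have "real (card {e \<in> M. mismatched r e}) - 1 \<le> real n" by simp
    then show ?thesis using fg_le[OF i rM(1,2)] unfolding rM(3,4) by linarith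
  qed
  define L where "L i = (\<Sum>p\<in>?P. \<Sum>t<5. sum_out m (\<lambda>X. f i (row m t p X)) 0 *
    sum_out m (\<lambda>Y. g i (column n m t p Y)) 0)" for i
  define R where "R i = (\<Sum>p\<in>?P. sum_in m (\<lambda>X. f i (row m 0 p X)) 0 *
    sum_in m (\<lambda>Y. g i (column n m 0 p Y)) 0)" for i
  have e0: "0 \<le> bias_error m" by (simp add: bias_error_def)
  have rect: "94 / 100 * L i \<le> 2 * (101 / 99)\<^sup>2 * R i + 10 * fact n * 2 ^ m * bias_error m * real n"
    if i: "i \<in> I" for i
  proof -
    have "94 / 100 * L i \<le> 2 * (101 / 99)\<^sup>2 * R i + 10 * fact n * 2 ^ m * bias_error m * (a i * b i)"
      unfolding L_def R_def
    proof (rule rectangle_bound[OF n])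
      fix r M assume rM: "r \<in> rows n" "M \<in> ?Ms" "card {e \<in> M. mismatched r e} = 1"
      then have "f i r * g i M \<le> 0" using fg_le[OF i rM(1,2)] by simp
      moreover have "0 \<le> f i r * g i M" using f g[OF rM(2)] by simp
      ultimately show "f i r * g i M = 0" by simp
    qed (use f g fa gb in auto)
    also have "10 * fact n * 2 ^ m * bias_error m * (a i * b i) \<le> 10 * fact n * 2 ^ m * bias_error m * real n"
      using ab[OF i] e0 by (intro mult_left_mono) auto
    finally show ?thesis by simp
  qed
  let ?O = "{X. X \<subseteq> {..m} \<and> (0::nat) \<notin> X}" and ?N = "{X. X \<subseteq> {..m} \<and> (0::nat) \<in> X}"
  have fact: "card ?P = fact n" by (simp add: card_permutations)
  have "(\<Sum>i\<in>I. L i) = (\<Sum>p\<in>?P. \<Sum>t<5. \<Sum>X\<in>?O. \<Sum>Y\<in>?O. \<Sum>i\<in>I. f i (row m t p X) * g i (column n m t p Y))"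
    unfolding L_def sum_out_def sum_product
    by (subst sum.swap, rule sum.cong[OF refl], subst sum.swap, rule sum.cong[OF refl],
        subst sum.swap, rule sum.cong[OF refl], subst sum.swap, rule refl)
  also have "\<dots> = (\<Sum>p\<in>?P. \<Sum>t<(5::nat). \<Sum>X\<in>?O. \<Sum>Y\<in>?O. 2)"
  proof (intro sum.cong refl)
    fix p t X Y assume "p \<in> ?P" "t \<in> {..<(5::nat)}" "X \<in> ?O" "Y \<in> ?O"
    then show "(\<Sum>i\<in>I. f i (row m t p X) * g i (column n m t p Y)) = 2"
      using slack[OF row_in_rows column_in_matchings, of t X m p t m p Y] n
        mismatched_row_column(2)[of t X m n p Y]
      by simp
  qed
  also have "\<dots> = fact n * 2 ^ m * 2 ^ m * 10"
    by (simp add: fact card_subsets_out)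
  finally have L: "(\<Sum>i\<in>I. L i) = fact n * 2 ^ m * 2 ^ m * 10" .
  have "(\<Sum>i\<in>I. R i) = (\<Sum>p\<in>?P. \<Sum>X\<in>?N. \<Sum>Y\<in>?N. \<Sum>i\<in>I. f i (row m 0 p X) * g i (column n m 0 p Y))"
    unfolding R_def sum_in_def sum_product
    by (subst sum.swap, rule sum.cong[OF refl],
        subst sum.swap, rule sum.cong[OF refl], subst sum.swap, rule refl)
  also have "\<dots> = (\<Sum>p\<in>?P. \<Sum>X\<in>?N. \<Sum>Y\<in>?N. 4)"
  proof (intro sum.cong refl)
    fix p X Y assume "p \<in> ?P" "X \<in> ?N" "Y \<in> ?N"
    then show "(\<Sum>i\<in>I. f i (row m 0 p X) * g i (column n m 0 p Y)) = 4"
      using slack[OF row_in_rows column_in_matchings, of 0 X m p 0 m p Y] n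
        mismatched_row_column(1)[of 0 X m n p Y]
      by simp
  qed
  also have "\<dots> = fact n * 2 ^ m * 2 ^ m * 4"
    by (simp add: fact card_subsets_in)
  finally have R: "(\<Sum>i\<in>I. R i) = fact n * 2 ^ m * 2 ^ m * 4" .
  define D :: real where "D = fact n * 2 ^ m * 2 ^ m"
  have "(\<Sum>i\<in>I. 94 / 100 * L i)
      \<le> (\<Sum>i\<in>I. 2 * (101 / 99)\<^sup>2 * R i + 10 * fact n * 2 ^ m * bias_error m * real n)"
    by (intro sum_mono rect)
  then have "94 / 100 * (\<Sum>i\<in>I. L i) \<le>
      2 * (101 / 99)\<^sup>2 * (\<Sum>i\<in>I. R i) + real (card I) * (10 * fact n * 2 ^ m * bias_error m * real n)"
    by (simp add: sum.distrib sum_distrib_left)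
  moreover have "real (card I) * (10 * fact n * 2 ^ m * bias_error m * real n)
      = D * (20 * real n * real (card I) * exp (- real (m + 1) / 4000000))"
    by (simp add: D_def bias_error_def)
  ultimately have main: "94 / 100 * (D * 10) \<le> 2 * (101 / 99)\<^sup>2 * (D * 4) +
      D * (20 * real n * real (card I) * exp (- real (m + 1) / 4000000))"
    unfolding L R D_def[symmetric] by simp
  have sq: "(101 / 99 :: real)\<^sup>2 = 10201 / 9801" by (simp add: power2_eq_square)
  have D: "0 < D" by (simp add: D_def)
  \<comment> \<open>Here \<open>94 / 100 * 10 - 8 * 10201 / 9801\<close> is about 1.07.\<close>
  have "D * 1 \<le> D * (20 * real n * real (card I) * exp (- real (m + 1) / 4000000))"
    using main D unfolding sq by linarith
  then show ?thesis using D by (simp only: mult_le_cancel_left_pos)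
qed

section \<open>From the slack matrix to the extension complexity\<close>

definition slack :: "nat \<Rightarrow> nat set \<times> nat set \<Rightarrow> (edge \<Rightarrow>\<^sub>0 real) \<Rightarrow> real" where
  "slack n r x = (\<Sum>e | e \<in> edges n \<and> mismatched r e. Poly_Mapping.lookup x e) - 1"

lemma affine_map_slack: "affine_map (slack n r)"
  unfolding slack_def
  by (intro affine_map_diff affine_map_sum affine_map_linear linear_lookup affine_map_const)

lemma slack_char_vector:
  assumes "M \<in> odd_perfect_matchings n"
  shows "slack n r (char_vector M) = real (card {e \<in> M. mismatched r e}) - 1"
proof -
  have M: "M \<subseteq> edges n" using assms by (simp add: odd_perfect_matchings_def perfect_matching_def)
  have fin: "finite (edges n)" by (simp add: edges_def)
  have "(\<Sum>e | e \<in> edges n \<and> mismatched r e. Poly_Mapping.lookup (char_vector M) e)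
      = (\<Sum>e | e \<in> edges n \<and> mismatched r e. indicator M e)"
    using lookup_char_vector[OF finite_matching[OF assms]] by simp
  also have "\<dots> = real (card ({e. e \<in> edges n \<and> mismatched r e} \<inter> M))"
    using fin by (simp add: indicator_def)
  also have "{e. e \<in> edges n \<and> mismatched r e} \<inter> M = {e \<in> M. mismatched r e}"
    using M by blast
  finally show ?thesis by (simp add: slack_def)
qed

lemma extension_complexity_bound:
  assumes n: "4 * m + 6 \<le> n"
  shows "1 \<le> 20 * real n * real (extension_complexity (odd_matching_polytope n) + 1)
    * exp (- real (m + 1) / 4000000)"
proof -
  let ?Ms = "odd_perfect_matchings n"
  let ?W = "char_vector ` ?Ms"
  have W: "finite ?W" "?W \<noteq> {}"
    using finite_odd_perfect_matchings column_exists[OF n] by auto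
  define L where "L r = (if r \<in> rows n then slack n r else (\<lambda>_. 0))" for r
  have L_affine: "affine_map (L r)" for r
    by (simp add: L_def affine_map_slack affine_map_const)
  have L_nonneg: "0 \<le> L r w" if w: "w \<in> ?W" for r w
  proof (cases "r \<in> rows n")
    case True
    obtain M where M: "M \<in> ?Ms" "w = char_vector M" using w by blast
    obtain S T where r: "r = (S, T)" by (cases r)
    have "odd (card {e \<in> M. mismatched r e})"
      using card_mismatched_odd[OF M(1), of S T] True r by (simp add: rows_def)
    then have "1 \<le> card {e \<in> M. mismatched r e}" by (simp add: odd_pos Suc_leI)
    then show ?thesis using True M by (simp add: L_def slack_char_vector)
  qed (simp add: L_def)
  obtain I :: "(nat \<Rightarrow>\<^sub>0 real) set set" and f g where I: "finite I"
      "card I \<le> extension_complexity (convex hull ?W) + 1"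
    and f: "\<forall>r j. 0 \<le> f j r" and g: "\<forall>w\<in>?W. \<forall>j. 0 \<le> g j w"
    and fg: "\<forall>r. \<forall>w\<in>?W. L r w = (\<Sum>j\<in>I. f j r * g j w)"
    by (rule slack_factorization[of ?W L, OF W L_affine L_nonneg])
  have "1 \<le> 20 * real n * real (card I) * exp (- real (m + 1) / 4000000)"
  proof (rule factorization_size[OF n I(1), where f = f and g = "\<lambda>j M. g j (char_vector M)"])
    fix r M assume "r \<in> rows n" "M \<in> ?Ms"
    then show "real (card {e \<in> M. mismatched r e}) - 1 = (\<Sum>i\<in>I. f i r * g i (char_vector M))"
      using fg[rule_format, of "char_vector M" r] by (simp add: L_def slack_char_vector)
  qed (use f g in auto)
  also have "\<dots> \<le> 20 * real n * real (extension_complexity (convex hull ?W) + 1)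
      * exp (- real (m + 1) / 4000000)"
    using I(2) by (intro mult_right_mono mult_left_mono of_nat_mono) auto
  finally show ?thesis unfolding odd_matching_polytope_def .
qed

lemma odd_perfect_matchings_nonempty:
  assumes "0 < n"
  shows "odd_perfect_matchings n \<noteq> {}"
proof -
  have "pairing n 0 {}" using assms by (simp add: pairing_def single_valued_def)
  then show ?thesis using matching_odd by blast
qed

theorem theorem1p2:
  shows "\<exists>c::real. c > 0 \<and>
           (\<forall>n::nat. n > 0 \<longrightarrow>
              2 powr (c * real n) \<le> real (extension_complexity (odd_matching_polytope n)))"
proof -
  \<comment> \<open>Halving the rate 1/16000000 leaves room to absorb the factor
    \<open>20 * real n\<close> and the summand 1.\<close>
  have "eventually (\<lambda>n::nat. 2 powr (1 / 32000000 * real n) + 1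
      \<le> exp ((real n - 6) / 16000000) / (20 * real n)) at_top"
    by real_asymp
  then obtain k where k: "\<And>n. n \<ge> k \<Longrightarrow> 2 powr (1 / 32000000 * real n) + 1
      \<le> exp ((real n - 6) / 16000000) / (20 * real n)"
    by (auto simp: eventually_at_top_linorder)
  \<comment> \<open>The second bound keeps \<open>2 powr (c * real n)\<close> at most 2 for
    \<open>n < k + 6\<close>, where only \<open>extension_complexity_ge_2\<close> is at
    hand.\<close>
  define c where "c = min (1 / 32000000) (1 / real (k + 6))"
  have c: "0 < c" "c \<le> 1 / 32000000" "c \<le> 1 / real (k + 6)" by (auto simp: c_def)
  have "2 powr (c * real n) \<le> real (extension_complexity (odd_matching_polytope n))" if n: "n > 0" for n
  proof (cases "n \<ge> k + 6")
    case False
    have "c * real n \<le> 1 / real (k + 6) * real (k + 6)"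
      using c False by (intro mult_mono) auto
    then have "c * real n \<le> 1" by simp
    then have "2 powr (c * real n) \<le> 2 powr 1" by (intro powr_mono) auto
    also have "\<dots> \<le> real (extension_complexity (odd_matching_polytope n))"
      using extension_complexity_ge_2[of "char_vector ` odd_perfect_matchings n"]
        finite_odd_perfect_matchings odd_perfect_matchings_nonempty[OF n]
      by (simp add: odd_matching_polytope_def)
    finally show ?thesis .
  next
    case True
    \<comment> \<open>The largest \<open>m\<close> whose frame fits into \<open>n\<close> vertices;
      \<open>m + 1\<close> is at least a quarter of \<open>n - 6\<close>, which turns 4000000 into
      16000000.\<close>
    define m where "m = (n - 6) div 4"
    define r where "r = real (extension_complexity (odd_matching_polytope n))"
    have m: "4 * m + 6 \<le> n" "n \<le> 4 * (m + 1) + 6" using True by (auto simp: m_def)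
    have "real n \<le> real (4 * (m + 1) + 6)" using m(2) by (rule of_nat_mono)
    then have "- real (m + 1) / 4000000 \<le> - ((real n - 6) / 16000000)" by (simp add: field_simps)
    then have "20 * real n * (r + 1) * exp (- real (m + 1) / 4000000)
        \<le> 20 * real n * (r + 1) * exp (- ((real n - 6) / 16000000))"
      by (intro mult_left_mono) (auto simp: r_def)
    moreover have "1 \<le> 20 * real n * (r + 1) * exp (- real (m + 1) / 4000000)"
      using extension_complexity_bound[OF m(1)] by (simp only: r_def of_nat_add of_nat_1)
    ultimately have "1 \<le> 20 * real n * (r + 1) * exp (- ((real n - 6) / 16000000))"
      by linarith
    then have "exp ((real n - 6) / 16000000) / (20 * real n) \<le> r + 1"
      using n by (simp add: exp_minus field_simps)
    then have "2 powr (1 / 32000000 * real n) \<le> r"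
      using k[of n] True by simp
    moreover have "2 powr (c * real n) \<le> 2 powr (1 / 32000000 * real n)"
      using c by (intro powr_mono mult_right_mono) auto
    ultimately show ?thesis unfolding r_def by linarith
  qed
  then show ?thesis using c(1) by blast
qed

end
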